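(* Let $G$ be a fundamental FHM-graph and let $\Pi_1,\dots,\Pi_p$ be all the (unordered) pairs of disjoint odd cycles of $G$. Suppose there is a choice of edges $b^1,\dots,b^p$ such that $b^i$ is a bridge of $\Pi_i$ for each $i$, with the following property. For each $i$, let $E_i$ be the even closed walk of $b^i$ in $\Pi_i$ and define its total weight $$a_i \;=\; 2 \;+\; \#\{e \in E_i : e\in \{b^1,\dots,b^p\}\setminus\{b^i\},\ e \text{ even-numbered in } E_i\} \;-\; \#\{e \in E_i : e\in \{b^1,\dots,b^p\}\setminus\{b^i\},\ e \text{ odd-numbered in } E_i\}.$$ (Equivalently: $b^i$ gets weight $2$, every other chosen bridge $b^j\neq b^i$ lying in $E_i$ gets weight $+1$ if it is an even-numbered edge of $E_i$ and $-1$ if it is odd-numbered, all other edges get weight $0$, and $a_i$ is the sum.) Assume $a_i\ge 0$ for all $i$, and that the number of indices $i$ with $a_i=0$ is at most $2$. Then the edge polytope $P_G$ possesses a regular unimodular triangulation.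
   Context: All graphs are finite, connected and simple (no loops, no multiple edges). Let $G$ have vertex set $\{1,\dots,d\}$ and edge set $E=\{e_1,\dots,e_n\}$. For an edge $e=\{i,j\}$ put $\rho(e)=\mathbf e_i+\mathbf e_j\in\mathbb Z^d$, where $\mathbf e_i$ is the $i$-th unit vector; the edge polytope $P_G\subset\mathbb R^d$ is the convex hull of $\{\rho(e): e\in E\}$. A regular unimodular triangulation of $P_G$ is a triangulation of $P_G$ by lattice simplices with vertices among the $\rho(e)$, all of normalized volume $1$, induced by a height function (lifting). Two odd cycles are disjoint if they have no common vertex. A bridge of a pair $(C,C')$ of disjoint odd cycles is an edge of $G$ with one endpoint on $C$ and the other on $C'$. An FHM-graph is a graph in which every pair of disjoint odd cycles has a bridge; a fundamental FHM-graph is an FHM-graph having at least one pair of disjoint odd cycles. For a bridge $b=\{u,v\}$ of $(C,C')$ with $u\in C$, $v\in C'$, the even closed walk of $b$ in $(C,C')$ is the closed walk $(e_{1},\dots,e_{2r})$ obtained by traversing $C$ once starting and ending at $u$, then $b$ from $u$ to $v$, then traversing $C'$ once starting and ending at $v$, then $b$ back from $v$ to $u$; here $2r=|C|+|C'|+2$, $b$ occupies positions $|C|+1$ and $2r$ (both even), and every other edge occurs exactly once. An edge of the walk is odd-numbered (resp. even-numbered) if its position is odd (resp. even); this parity does not depend on the directions in which $C$ and $C'$ are traversed. An edge is contained in the walk if it occurs in it. *)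

theory Defs
  imports "HOL-Analysis.Analysis"
begin

(* Graphs: vertex set = UNIV of a finite type 'n (d = CARD('n)); edges are 2-element sets. *)

definition simple_graph :: "'n set set \<Rightarrow> bool" where
  "simple_graph E \<longleftrightarrow> (\<forall>e\<in>E. card e = 2)"

definition connected_graph :: "'n set set \<Rightarrow> bool" where
  "connected_graph E \<longleftrightarrow> (\<forall>u v. (u, v) \<in> {(x, y). {x, y} \<in> E}\<^sup>*)"

(* a cycle given as a list of distinct vertices v_0,...,v_{k-1}, k >= 3, with
   edges {v_i, v_{i+1 mod k}} in E *)
definition cycle_list :: "'n set set \<Rightarrow> 'n list \<Rightarrow> bool" where
  "cycle_list E vs \<longleftrightarrow> distinct vs \<and> length vs \<ge> 3 \<and>
     (\<forall>i < length vs. {vs ! i, vs ! (Suc i mod length vs)} \<in> E)"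

(* the edges of the cycle, traversed once starting and ending at hd vs *)
definition cyc_walk :: "'n list \<Rightarrow> 'n set list" where
  "cyc_walk vs = map (\<lambda>i. {vs ! i, vs ! (Suc i mod length vs)}) [0..<length vs]"

(* a cycle of G, identified with its edge set *)
definition is_cycle :: "'n set set \<Rightarrow> 'n set set \<Rightarrow> bool" where
  "is_cycle E C \<longleftrightarrow> (\<exists>vs. cycle_list E vs \<and> C = set (cyc_walk vs))"

definition odd_cycle :: "'n set set \<Rightarrow> 'n set set \<Rightarrow> bool" where
  "odd_cycle E C \<longleftrightarrow> is_cycle E C \<and> odd (card C)"

definition cycle_verts :: "'n set set \<Rightarrow> 'n set" where
  "cycle_verts C = \<Union>C"

definition disjoint_cycles :: "'n set set \<Rightarrow> 'n set set \<Rightarrow> bool" where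
  "disjoint_cycles C C' \<longleftrightarrow> cycle_verts C \<inter> cycle_verts C' = {}"

definition is_bridge :: "'n set set \<Rightarrow> 'n set set \<Rightarrow> 'n set set \<Rightarrow> 'n set \<Rightarrow> bool" where
  "is_bridge E C C' b \<longleftrightarrow> b \<in> E \<and>
     (\<exists>u v. b = {u, v} \<and> u \<in> cycle_verts C \<and> v \<in> cycle_verts C')"

definition FHM_graph :: "'n set set \<Rightarrow> bool" where
  "FHM_graph E \<longleftrightarrow> (\<forall>C C'. odd_cycle E C \<and> odd_cycle E C' \<and> disjoint_cycles C C'
      \<longrightarrow> (\<exists>b. is_bridge E C C' b))"

definition fundamental_FHM_graph :: "'n set set \<Rightarrow> bool" where
  "fundamental_FHM_graph E \<longleftrightarrow> FHM_graph E \<and>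
     (\<exists>C C'. odd_cycle E C \<and> odd_cycle E C' \<and> disjoint_cycles C C')"

(* the set of all unordered pairs {C, C'} of disjoint odd cycles *)
definition odd_cycle_pairs :: "'n set set \<Rightarrow> 'n set set set set" where
  "odd_cycle_pairs E = {{C, C'} | C C'. odd_cycle E C \<and> odd_cycle E C' \<and> disjoint_cycles C C'}"

(* a bridge of an unordered pair *)
definition is_bridge_of_pair :: "'n set set \<Rightarrow> 'n set set set \<Rightarrow> 'n set \<Rightarrow> bool" where
  "is_bridge_of_pair E P b \<longleftrightarrow> (\<exists>C C'. P = {C, C'} \<and> is_bridge E C C' b)"

(* W is the even closed walk of the bridge b={u,v} in (C, C'), u in C, v in C':
   traverse C from u, then b, then C' from v, then b.  Position of W ! j is j+1. *)
definition even_closed_walk :: "'n set set \<Rightarrow> 'n set \<Rightarrow> 'n set set \<Rightarrow> 'n set set \<Rightarrow> 'n set list \<Rightarrow> bool" where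
  "even_closed_walk E b C C' W \<longleftrightarrow> (\<exists>u v cs cs'. b = {u, v} \<and>
      cycle_list E cs \<and> set (cyc_walk cs) = C \<and> hd cs = u \<and>
      cycle_list E cs' \<and> set (cyc_walk cs') = C' \<and> hd cs' = v \<and>
      W = cyc_walk cs @ [b] @ cyc_walk cs' @ [b])"

definition odd_numbered :: "'n set list \<Rightarrow> 'n set \<Rightarrow> bool" where
  "odd_numbered W e \<longleftrightarrow> (\<exists>j < length W. W ! j = e \<and> odd (Suc j))"

definition even_numbered :: "'n set list \<Rightarrow> 'n set \<Rightarrow> bool" where
  "even_numbered W e \<longleftrightarrow> (\<exists>j < length W. W ! j = e \<and> even (Suc j))"

(* total weight a of the pair P w.r.t. the chosen bridges B = {b^1,...,b^p}, with b = bridge of P;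
   the walk is any even closed walk of b in P (parities do not depend on the choice) *)
definition total_weight :: "'n set set \<Rightarrow> 'n set set \<Rightarrow> 'n set \<Rightarrow> 'n set set set \<Rightarrow> int" where
  "total_weight E B b P =
    (let W = (SOME W. \<exists>C C'. P = {C, C'} \<and> even_closed_walk E b C C' W) in
      2 + int (card {e \<in> set W. e \<in> B - {b} \<and> even_numbered W e})
        - int (card {e \<in> set W. e \<in> B - {b} \<and> odd_numbered W e}))"

(* Edge polytope *)
definition rho :: "'n::finite set \<Rightarrow> real^'n" where
  "rho e = (\<chi> i. if i \<in> e then 1 else 0)"

definition edge_polytope :: "'n::finite set set \<Rightarrow> (real^'n) set" where
  "edge_polytope E = convex hull (rho ` E)"

(* Triangulations of a point configuration A (cells = maximal simplices with vertices in A) *)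
definition lattice_point :: "real^'n \<Rightarrow> bool" where
  "lattice_point x \<longleftrightarrow> (\<forall>i. x $ i \<in> \<int>)"

definition triangulation :: "(real^'n) set \<Rightarrow> (real^'n) set set \<Rightarrow> bool" where
  "triangulation A T \<longleftrightarrow> finite T \<and>
     (\<forall>S\<in>T. S \<subseteq> A \<and> \<not> affine_dependent S \<and> affine hull S = affine hull A) \<and>
     \<Union> ((\<lambda>S. convex hull S) ` T) = convex hull A \<and>
     (\<forall>S\<in>T. \<forall>S'\<in>T. convex hull S \<inter> convex hull S' = convex hull (S \<inter> S'))"

(* regular: induced by a height function w on A (cells = lower faces of the lifting) *)
definition regular_triangulation :: "(real^'n) set \<Rightarrow> (real^'n) set set \<Rightarrow> bool" where
  "regular_triangulation A T \<longleftrightarrow> triangulation A T \<and>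
     (\<exists>w :: real^'n \<Rightarrow> real. \<forall>S\<in>T. \<exists>c :: real^'n. \<exists>h :: real.
        (\<forall>v\<in>S. w v = c \<bullet> v + h) \<and> (\<forall>v\<in>A - S. w v > c \<bullet> v + h))"

(* lattice simplex of normalized volume 1 (w.r.t. the lattice Z^d restricted to its affine hull):
   vertices are affinely independent lattice points and every lattice point of the affine hull
   is an integer affine combination of the vertices *)
definition unimodular_simplex :: "(real^'n) set \<Rightarrow> bool" where
  "unimodular_simplex S \<longleftrightarrow> finite S \<and> \<not> affine_dependent S \<and> (\<forall>v\<in>S. lattice_point v) \<and>
     (\<forall>x. lattice_point x \<and> x \<in> affine hull S \<longrightarrow>
        (\<exists>c. (\<forall>v\<in>S. c v \<in> \<int>) \<and> sum c S = 1 \<and> (\<Sum>v\<in>S. c v *\<^sub>R v) = x))"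

definition has_regular_unimodular_triangulation :: "(real^'n) set \<Rightarrow> bool" where
  "has_regular_unimodular_triangulation A \<longleftrightarrow>
     (\<exists>T. regular_triangulation A T \<and> (\<forall>S\<in>T. unimodular_simplex S))"

end

theory Submission
  imports Defs
begin

text \<open>A maximal simplex of a triangulation of the edge polytope of a connected non-bipartite graph is
  spanned by the edges of a spanning subgraph each of whose components contains an odd cycle. If no
  two odd cycles of this subgraph are disjoint, then it is connected and not bipartite, and walks of
  both parities between any two vertices show that its edges generate the lattice of integer vectors
  with even coordinate sum, so that the simplex is unimodular. Hence it suffices to find generic
  heights for which no cell contains all edges of two disjoint odd cycles. The edge vectors of an even
  closed walk have alternating sum zero, and the odd-numbered edges of the walk of a pair lie on its
  two cycles; therefore heights with negative alternating sum over this walk separate the pair.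
  The negated indicator of the set of chosen bridges has alternating sum $-a_i$, and a
  perturbation takes care of the at most two pairs with $a_i = 0$.\<close>

subsection \<open>Regular triangulations from generic heights\<close>

lemma rho_nth: "rho e $ i = (if i \<in> e then 1 else 0)"
  by (simp add: rho_def)

lemma inj_rho: "inj rho"
  by (rule injI) (metis rho_nth set_eqI zero_neq_one)

lemma inner_rho: "c \<bullet> rho e = (\<Sum>i\<in>e. c $ i)"
  unfolding inner_vec_def rho_nth by (simp add: if_distrib sum.If_cases cong: if_cong)

text \<open>Pairing a linear combination of \<open>S\<close> with \<open>a\<close> returns the sum
  of its coefficients, so on the hyperplane linear combinations are automatically affine. Linear
  bases can thus replace affine ones below.\<close>

lemma affine_hull_spanning_in_hyperplane:
  fixes S :: "'a::euclidean_space set"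
  assumes "finite S" "span S = UNIV" "\<And>v. v \<in> S \<Longrightarrow> a \<bullet> v = 1"
  shows "affine hull S = {x. a \<bullet> x = 1}"
proof
  show "affine hull S \<subseteq> {x. a \<bullet> x = 1}"
    using assms by (intro hull_minimal) (auto simp: affine_hyperplane)
  show "{x. a \<bullet> x = 1} \<subseteq> affine hull S"
  proof
    fix x assume x: "x \<in> {x. a \<bullet> x = 1}"
    have "x \<in> span S" using assms by auto
    then obtain c where c: "x = (\<Sum>v\<in>S. c v *\<^sub>R v)"
      using span_finite[OF \<open>finite S\<close>] by auto
    have "1 = (\<Sum>v\<in>S. c v * (a \<bullet> v))"
      using x unfolding c by (simp add: inner_sum_right)
    also have "\<dots> = sum c S" using assms by (intro sum.cong) auto
    finally show "x \<in> affine hull S"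
      unfolding affine_hull_finite[OF \<open>finite S\<close>] using c by auto
  qed
qed

text \<open>A linear extension of \<open>w\<close> from \<open>S\<close> is an inner product with a
  fixed vector, the value of its adjoint at 1. It supplies the functional through the lifted points
  of a basis.\<close>

lemma independent_prescribed_inner:
  fixes S :: "'a::euclidean_space set" and w :: "'a \<Rightarrow> real"
  assumes "independent S"
  shows "\<exists>c. \<forall>v\<in>S. c \<bullet> v = w v"
proof -
  obtain f :: "'a \<Rightarrow> real" where f: "linear f" "\<forall>v\<in>S. f v = w v"
    using linear_independent_extend[OF assms] by blast
  have "adjoint f (1::real) \<bullet> v = f v" for v
    using adjoint_works[OF f(1), of v "1::real"] by (simp add: inner_commute)
  then show ?thesis using f(2) by metis
qed

text \<open>Genericity excludes ties. The functional has no constant term, which loses nothing for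
  points with \<open>a \<bullet> v = 1\<close>, where a constant is a multiple of
  \<open>a\<close>.\<close>

definition generic_height :: "'a::euclidean_space set \<Rightarrow> ('a \<Rightarrow> real) \<Rightarrow> bool" where
  "generic_height A w \<longleftrightarrow> (\<forall>S c u. S \<subseteq> A \<longrightarrow> independent S \<longrightarrow> span S = UNIV \<longrightarrow>
     (\<forall>v\<in>S. c \<bullet> v = w v) \<longrightarrow> u \<in> A - S \<longrightarrow> c \<bullet> u \<noteq> w u)"

text \<open>For generic \<open>w\<close> and points on such a hyperplane, these are the
  full-dimensional cells of the lower hull of the lifting.\<close>

definition lower_simplices :: "'a::euclidean_space set \<Rightarrow> ('a \<Rightarrow> real) \<Rightarrow> 'a set set" where
  "lower_simplices A w = {S. S \<subseteq> A \<and> independent S \<and> span S = UNIV \<and>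
     (\<exists>c. (\<forall>v\<in>S. w v = c \<bullet> v) \<and> (\<forall>v\<in>A - S. w v > c \<bullet> v))}"

text \<open>A simplex-method argument: among the bases whose hull contains \<open>z\<close>, one of least lifted
  height over \<open>z\<close> is a lower simplex, since otherwise a pivot step would decrease the height.\<close>

lemma lower_simplices_cover_generic:
  fixes A :: "'a::euclidean_space set"
  assumes fin: "finite A" and spA: "span A = UNIV" and hyp: "\<And>v. v \<in> A \<Longrightarrow> a \<bullet> v = 1"
    and gen: "generic_height A w"
    and zA: "z \<in> convex hull A"
    and zgen: "\<And>S. S \<subseteq> A \<Longrightarrow> z \<in> span S \<Longrightarrow> span S = UNIV"
  shows "\<exists>S\<in>lower_simplices A w. z \<in> convex hull S"
proof -
  \<comment> \<open>Since \<open>z\<close> avoids all proper spans, at most \<open>DIM('a)\<close>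
    points with \<open>z\<close> in their hull must already form a basis.\<close>
  have basis: "independent S \<and> span S = UNIV \<and> card S = DIM('a)"
    if S: "S \<subseteq> A" "z \<in> convex hull S" "card S \<le> DIM('a)" for S
  proof -
    have "z \<in> span S" using S(2) convex_hull_subset_span by blast
    then have sp: "span S = UNIV" using zgen S(1) by blast
    moreover have "finite S" using S(1) fin finite_subset by blast
    ultimately have "independent S"
      using card_le_dim_spanning[of S UNIV] S(3) by auto
    moreover have "card S = DIM('a)"
      using dim_eq_card[of S UNIV] sp \<open>independent S\<close> by (metis dim_UNIV span_UNIV)
    ultimately show ?thesis using sp by blast
  qed
  \<comment> \<open>Candidate bases with their lifting functional; \<open>c \<bullet> z\<close> is
    the height of the lifted simplex over \<open>z\<close>.\<close>
  define K where "K = {(S, c). S \<subseteq> A \<and> z \<in> convex hull S \<and> card S \<le> DIM('a) \<and> (\<forall>v\<in>S. c \<bullet> v = w v)}"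
  define H where "H = (\<lambda>(S::'a set, c). c \<bullet> z) ` K"
  have a0: "a \<noteq> 0"
  proof
    assume "a = 0"
    then have "A = {}" using hyp by auto
    then show False using zA by simp
  qed
  \<comment> \<open>The affine dimension is one less than that of the space, so Caratheodory's
    theorem yields the bound \<open>DIM('a)\<close>.\<close>
  have "aff_dim A = DIM('a) - 1"
    using affine_hull_spanning_in_hyperplane[OF fin spA hyp] aff_dim_hyperplane[OF a0, of 1]
    by (metis aff_dim_affine_hull)
  then obtain S0 where S0: "S0 \<subseteq> A" "card S0 \<le> DIM('a)" "z \<in> convex hull S0"
    using zA unfolding caratheodory_aff_dim[of A] by auto
  have Kne: "K \<noteq> {}"
    using independent_prescribed_inner[of S0 w] basis[OF S0(1,3,2)] S0 unfolding K_def by blast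
  have uniq: "c = c'" if "(S, c) \<in> K" "(S, c') \<in> K" for S c c'
  proof -
    have "span S = UNIV" using that(1) basis unfolding K_def by blast
    moreover have "span S \<subseteq> {x. (c - c') \<bullet> x = 0}"
      using that unfolding K_def
      by (intro span_minimal subspace_hyperplane) (auto simp: inner_diff_left)
    ultimately have "(c - c') \<bullet> (c - c') = 0" by blast
    then show ?thesis by simp
  qed
  have finK: "finite K"
  proof -
    have "inj_on fst K" using uniq by (auto simp: inj_on_def)
    moreover have "fst ` K \<subseteq> Pow A" unfolding K_def by auto
    ultimately show ?thesis using fin by (meson finite_Pow_iff finite_imageD finite_subset)
  qed
  obtain p where p: "p \<in> K" and pmin: "\<And>q. q \<in> K \<Longrightarrow> snd p \<bullet> z \<le> snd q \<bullet> z"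
    using ex_is_arg_min_if_finite[OF finK Kne, of "\<lambda>q. snd q \<bullet> z"]
    unfolding is_arg_min_linorder by blast
  obtain S c where Sc: "p = (S, c)" by fastforce
  have S: "S \<subseteq> A" "z \<in> convex hull S" "card S \<le> DIM('a)" "\<And>v. v \<in> S \<Longrightarrow> c \<bullet> v = w v"
    using p unfolding Sc K_def by auto
  have ind: "independent S" and sp: "span S = UNIV" and cS: "card S = DIM('a)"
    using basis[OF S(1-3)] by auto
  have finS: "finite S" using S(1) fin finite_subset by blast
  obtain l where l0: "\<And>v. v \<in> S \<Longrightarrow> l v \<ge> 0" and l1: "sum l S = 1"
    and lz: "(\<Sum>v\<in>S. l v *\<^sub>R v) = z"
    using S(2) unfolding convex_hull_finite[OF finS] by blast
  have lpos: "l v > 0" if v: "v \<in> S" for v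
  proof (rule ccontr)
    assume "\<not> l v > 0"
    then have "l v = 0" using l0[OF v] by simp
    then have "z = (\<Sum>u\<in>S - {v}. l u *\<^sub>R u)"
      using lz finS v by (simp add: sum.remove)
    then have "z \<in> span (S - {v})"
      by (simp only:) (intro span_sum span_scale span_base)
    then have "span (S - {v}) = UNIV" using zgen[of "S - {v}"] S(1) by blast
    then show False using ind v unfolding dependent_def by auto
  qed
  have "c \<bullet> u < w u" if u: "u \<in> A - S" for u
  proof (rule ccontr)
    assume "\<not> c \<bullet> u < w u"
    moreover have "c \<bullet> u \<noteq> w u"
      using gen S ind sp u unfolding generic_height_def by blast
    ultimately have less: "w u < c \<bullet> u" by simp
    obtain m where m: "u = (\<Sum>v\<in>S. m v *\<^sub>R v)"
      using span_finite[OF finS] sp by auto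
    have "1 = (\<Sum>v\<in>S. m v * (a \<bullet> v))"
      using hyp[of u] u arg_cong[OF m, of "inner a"] by (simp add: inner_sum_right)
    also have "\<dots> = sum m S" using hyp S(1) by (intro sum.cong) auto
    finally have m1: "sum m S = 1" by simp
    \<comment> \<open>Ratio test: as weight \<open>t\<close> shifts to the entering vector
      \<open>u\<close>, the vector \<open>r\<close> whose coefficient first reaches 0 leaves the
      basis. \<open>Q\<close> is nonempty because the coefficients \<open>m\<close> sum to
      1.\<close>
    define Q where "Q = {v\<in>S. m v > 0}"
    have "Q \<noteq> {}"
    proof
      assume "Q = {}"
      then have "sum m S \<le> 0" unfolding Q_def by (intro sum_nonpos) force
      then show False using m1 by simp
    qed
    moreover have "finite Q" using finS unfolding Q_def by simp
    ultimately obtain r where r: "r \<in> Q" "\<And>v. v \<in> Q \<Longrightarrow> l r / m r \<le> l v / m v"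
      using ex_is_arg_min_if_finite[of Q "\<lambda>v. l v / m v"] unfolding is_arg_min_linorder by blast
    have rS: "r \<in> S" and mr: "m r > 0" using r(1) unfolding Q_def by auto
    define t where "t = l r / m r"
    have t0: "t > 0" using lpos[OF rS] mr unfolding t_def by simp
    define k where "k v = l v - t * m v" for v
    have kr: "k r = 0" unfolding k_def t_def using mr by simp
    have k0: "k v \<ge> 0" if v: "v \<in> S" for v
    proof (cases "m v > 0")
      case True
      then have "t \<le> l v / m v" using r(2) v unfolding t_def Q_def by simp
      then show ?thesis using True unfolding k_def by (simp add: field_simps)
    next
      case False
      then have "t * m v \<le> 0" using t0 by (simp add: mult_nonneg_nonpos)
      then show ?thesis using l0[OF v] unfolding k_def by simp
    qed
    define S' where "S' = insert u (S - {r})"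
    have uS: "u \<notin> S - {r}" using u by simp
    have zS: "z = t *\<^sub>R u + (\<Sum>v\<in>S - {r}. k v *\<^sub>R v)"
    proof -
      have "(\<Sum>v\<in>S - {r}. k v *\<^sub>R v) = (\<Sum>v\<in>S. k v *\<^sub>R v)"
        using finS rS kr by (simp add: sum.remove)
      also have "\<dots> = z - t *\<^sub>R u"
        unfolding k_def lz[symmetric] m
        by (simp add: scaleR_diff_left sum_subtractf scaleR_sum_right)
      finally show ?thesis by simp
    qed
    have k1: "t + sum k (S - {r}) = 1"
    proof -
      have "sum k (S - {r}) = sum k S" using finS rS kr by (simp add: sum.remove)
      also have "\<dots> = 1 - t"
        unfolding k_def by (simp add: sum_subtractf l1 m1 flip: sum_distrib_left)
      finally show ?thesis by simp
    qed
    have zS': "z \<in> convex hull S'"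
    proof -
      define k' where "k' = k(u := t)"
      have eq: "sum k' (S - {r}) = sum k (S - {r})"
        "(\<Sum>v\<in>S - {r}. k' v *\<^sub>R v) = (\<Sum>v\<in>S - {r}. k v *\<^sub>R v)"
        unfolding k'_def using uS by (metis (mono_tags, lifting) fun_upd_other sum.cong)+
      have "\<forall>v\<in>S'. 0 \<le> k' v" "sum k' S' = 1" "(\<Sum>v\<in>S'. k' v *\<^sub>R v) = z"
        using k0 t0 k1 zS finS uS eq unfolding S'_def by (auto simp: k'_def)
      then show ?thesis unfolding S'_def using finS by (subst convex_hull_finite) auto
    qed
    have S'A: "S' \<subseteq> A" using S(1) u unfolding S'_def by auto
    have cS': "card S' \<le> DIM('a)"
      unfolding S'_def using card_insert_le_m1 finS rS cS
      by (metis card_Diff_singleton card_gt_0_iff empty_iff order_refl)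
    obtain c' where c': "\<forall>v\<in>S'. c' \<bullet> v = w v"
      using independent_prescribed_inner[of S' w] basis[OF S'A zS' cS'] by blast
    have "(S', c') \<in> K" using S'A zS' cS' c' unfolding K_def by auto
    then have "c \<bullet> z \<le> c' \<bullet> z" using pmin Sc by fastforce
    moreover have "c' \<bullet> z = t * w u + (\<Sum>v\<in>S - {r}. k v * w v)"
      using c' unfolding zS S'_def by (simp add: inner_add_right inner_sum_right)
    moreover have "c \<bullet> z = t * (c \<bullet> u) + (\<Sum>v\<in>S - {r}. k v * w v)"
      using S(4) unfolding zS by (simp add: inner_add_right inner_sum_right)
    ultimately show False using less t0 by simp
  qed
  then have "S \<in> lower_simplices A w"
    using S ind sp unfolding lower_simplices_def
    by (intro CollectI conjI exI[of _ c]) auto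
  then show ?thesis using S(2) by blast
qed

text \<open>The proper spans are finitely many null sets, whereas the pyramid over \<open>A\<close>
  with apex 0 has interior points. An interior point off these spans is scaled into the hull of
  \<open>A\<close>.\<close>

lemma exists_point_off_proper_spans:
  fixes A :: "'a::euclidean_space set"
  assumes fin: "finite A" and spA: "span A = UNIV" and hyp: "\<And>v. v \<in> A \<Longrightarrow> a \<bullet> v = 1"
  shows "\<exists>y\<in>convex hull A. \<forall>S\<subseteq>A. y \<in> span S \<longrightarrow> span S = UNIV"
proof -
  define X where "X = (\<Union>S\<in>{S. S \<subseteq> A \<and> span S \<noteq> UNIV}. span S)"
  have negl: "negligible (span S)" if "span S \<noteq> UNIV" for S :: "'a set"
  proof -
    have "dim S < DIM('a)" using that dim_eq_full[of S] dim_subset_UNIV[of S] by linarith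
    then show ?thesis by (intro negligible_lowdim) simp
  qed
  have "negligible X"
    unfolding X_def using fin negl by (intro negligible_Union) auto
  have "affine hull (convex hull (insert 0 A)) = UNIV"
    using spA by (simp add: affine_hull_span_0 hull_inc span_insert_0)
  then have "interior (convex hull (insert 0 A)) = rel_interior (convex hull (insert 0 A))"
    by (simp only: rel_interior_interior)
  then have "interior (convex hull (insert 0 A)) \<noteq> {}"
    by (simp add: rel_interior_eq_empty)
  then have "\<not> negligible (interior (convex hull (insert 0 A)))"
    using open_not_negligible by blast
  moreover have "negligible (insert 0 X)" using \<open>negligible X\<close> by simp
  ultimately obtain y0 where y0: "y0 \<in> interior (convex hull (insert 0 A))" "y0 \<notin> insert 0 X"
    using negligible_subset by blast
  have y0h: "y0 \<in> convex hull (insert 0 A)" using y0(1) interior_subset by blast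
  then have "A \<noteq> {}" using y0(2) by auto
  then obtain s y where "y \<in> convex hull A" "y0 = s *\<^sub>R y"
    using y0h by (auto simp: convex_hull_insert)
  moreover have "y \<in> span S \<longrightarrow> span S = UNIV" if "S \<subseteq> A" for S
    using y0(2) that span_scale[of y S s] \<open>y0 = s *\<^sub>R y\<close> unfolding X_def by blast
  ultimately show ?thesis by blast
qed

text \<open>Points off all proper spans are covered already. Any \<open>x\<close> is a limit of such
  points along the segment towards a general point \<open>y\<close>, and the finite union of compact
  hulls is closed.\<close>

lemma lower_simplices_cover:
  fixes A :: "'a::euclidean_space set"
  assumes fin: "finite A" and spA: "span A = UNIV" and hyp: "\<And>v. v \<in> A \<Longrightarrow> a \<bullet> v = 1"
    and gen: "generic_height A w"
  shows "(\<Union>S\<in>lower_simplices A w. convex hull S) = convex hull A"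
proof
  have sub: "S \<subseteq> A" if "S \<in> lower_simplices A w" for S
    using that unfolding lower_simplices_def by blast
  then show "(\<Union>S\<in>lower_simplices A w. convex hull S) \<subseteq> convex hull A"
    using hull_mono by blast
  have "finite (lower_simplices A w)"
    using finite_subset[of _ "Pow A"] fin sub by blast
  then have cl: "closed (\<Union>S\<in>lower_simplices A w. convex hull S)"
    using sub fin
    by (intro closed_UN) (auto intro!: compact_imp_closed finite_imp_compact_convex_hull dest: finite_subset)
  obtain y where y: "y \<in> convex hull A" and ygen: "\<And>S. S \<subseteq> A \<Longrightarrow> y \<in> span S \<Longrightarrow> span S = UNIV"
    using exists_point_off_proper_spans[OF fin spA hyp] by blast
  show "convex hull A \<subseteq> (\<Union>S\<in>lower_simplices A w. convex hull S)"
  proof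
    fix x assume x: "x \<in> convex hull A"
    define p where "p t = x + t *\<^sub>R (y - x)" for t
    define X where "X = (\<Union>S\<in>{S. S \<subseteq> A \<and> span S \<noteq> UNIV}. {t. p t \<in> span S})"
    have "finite {t. p t \<in> span S}" if S: "S \<subseteq> A" "span S \<noteq> UNIV" for S
    proof -
      \<comment> \<open>Two points of the line in one span would put its direction, and with it
        \<open>y\<close>, into that span.\<close>
      have "s = t" if st: "p s \<in> span S" "p t \<in> span S" for s t
      proof (rule ccontr)
        assume ne: "s \<noteq> t"
        have "p s - p t \<in> span S" using st span_diff by blast
        then have "(s - t) *\<^sub>R (y - x) \<in> span S"
          unfolding p_def by (simp add: scaleR_diff_left)
        then have d: "y - x \<in> span S"
          using ne span_scale[of "(s - t) *\<^sub>R (y - x)" S "inverse (s - t)"] by simp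
        have "y = p s + (1 - s) *\<^sub>R (y - x)" unfolding p_def by (simp add: algebra_simps)
        then have "y \<in> span S" using d st(1) span_add span_scale by metis
        then show False using ygen S by blast
      qed
      \<comment> \<open>A set with at most one element maps injectively to the unit type, hence is
        finite.\<close>
      then have "inj_on (\<lambda>_. ()) {t. p t \<in> span S}" by (intro inj_onI) simp
      then show ?thesis using finite_imageD finite by blast
    qed
    then have finX: "finite X" unfolding X_def using fin by auto
    have cov: "p t \<in> (\<Union>S\<in>lower_simplices A w. convex hull S)" if t: "0 < t" "t < 1" "t \<notin> X" for t
    proof -
      have "p t \<in> convex hull A"
        unfolding p_def using convexD_alt[OF convex_convex_hull x y, of t] t
        by (simp add: algebra_simps)
      moreover have "span S = UNIV" if "S \<subseteq> A" "p t \<in> span S" for S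
        using t(3) that unfolding X_def by blast
      ultimately show ?thesis
        using lower_simplices_cover_generic[OF fin spA hyp gen] by blast
    qed
    have "(p \<longlongrightarrow> p 0) (at_right 0)"
      unfolding p_def by (intro tendsto_intros)
    moreover have "\<forall>\<^sub>F t in at_right 0. p t \<in> (\<Union>S\<in>lower_simplices A w. convex hull S)"
    proof -
      have "\<forall>\<^sub>F t in at_right (0::real). 0 < t \<and> t < 1"
        using eventually_at_right_real[of 0 "1::real"] by simp
      moreover have "\<forall>\<^sub>F t in at_right (0::real). t \<notin> X"
      proof -
        have "\<not> 0 islimpt X" using finX by (simp add: islimpt_finite)
        then have "\<forall>\<^sub>F t in at 0. t \<notin> X" by (simp add: islimpt_iff_eventually)
        then show ?thesis by (simp add: eventually_at_split)
      qed
      ultimately show ?thesis by eventually_elim (use cov in blast)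
    qed
    ultimately have "p 0 \<in> (\<Union>S\<in>lower_simplices A w. convex hull S)"
      using Lim_in_closed_set[OF cl] trivial_limit_at_right_real by blast
    then show "x \<in> (\<Union>S\<in>lower_simplices A w. convex hull S)"
      unfolding p_def by simp
  qed
qed

text \<open>The two sides differ by the sum of the nonnegative terms
  \<open>l v * (w v - c \<bullet> v)\<close>; if it vanishes, so does each term, and off
  \<open>S\<close> the second factor is positive.\<close>

lemma lower_face_le_combination:
  assumes fin: "finite A" and SA: "S \<subseteq> A" "S' \<subseteq> A"
    and c: "\<And>v. v \<in> S \<Longrightarrow> w v = c \<bullet> v" "\<And>v. v \<in> A - S \<Longrightarrow> w v > c \<bullet> v"
    and l: "\<And>v. v \<in> S' \<Longrightarrow> 0 \<le> l v"
  shows "c \<bullet> (\<Sum>v\<in>S'. l v *\<^sub>R v) \<le> (\<Sum>v\<in>S'. l v * w v)"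
    and "c \<bullet> (\<Sum>v\<in>S'. l v *\<^sub>R v) = (\<Sum>v\<in>S'. l v * w v) \<Longrightarrow> v \<in> S' - S \<Longrightarrow> l v = 0"
proof -
  have fS': "finite S'" using SA fin finite_subset by blast
  have diff: "(\<Sum>v\<in>S'. l v * w v) - c \<bullet> (\<Sum>v\<in>S'. l v *\<^sub>R v) = (\<Sum>v\<in>S'. l v * (w v - c \<bullet> v))"
    by (simp add: inner_sum_right right_diff_distrib sum_subtractf)
  have nn: "0 \<le> l v * (w v - c \<bullet> v)" if "v \<in> S'" for v
    using that c(1)[of v] c(2)[of v] l[of v] SA by (cases "v \<in> S") (auto intro!: mult_nonneg_nonneg)
  then have "0 \<le> (\<Sum>v\<in>S'. l v * (w v - c \<bullet> v))" by (rule sum_nonneg)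
  with diff show "c \<bullet> (\<Sum>v\<in>S'. l v *\<^sub>R v) \<le> (\<Sum>v\<in>S'. l v * w v)" by linarith
  assume "c \<bullet> (\<Sum>v\<in>S'. l v *\<^sub>R v) = (\<Sum>v\<in>S'. l v * w v)" and v: "v \<in> S' - S"
  then have "(\<Sum>v\<in>S'. l v * (w v - c \<bullet> v)) = 0" using diff by simp
  then have "l v * (w v - c \<bullet> v) = 0"
    using nn v fS' by (subst (asm) sum_nonneg_eq_0_iff) auto
  moreover have "w v - c \<bullet> v > 0" using c(2)[of v] v SA by auto
  ultimately show "l v = 0" by simp
qed

text \<open>Over a common point \<open>x\<close>, the height read off from either cell is at most
  that from the other. Equality forces the convex coefficients to vanish outside the common
  vertices.\<close>

lemma lower_simplices_inter:
  fixes A :: "'a::euclidean_space set"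
  assumes fin: "finite A" and S: "S \<in> lower_simplices A w" and S': "S' \<in> lower_simplices A w"
  shows "convex hull S \<inter> convex hull S' = convex hull (S \<inter> S')"
proof
  show "convex hull (S \<inter> S') \<subseteq> convex hull S \<inter> convex hull S'"
    by (simp add: hull_mono)
  obtain c where c: "\<And>v. v \<in> S \<Longrightarrow> w v = c \<bullet> v" "\<And>v. v \<in> A - S \<Longrightarrow> w v > c \<bullet> v" and SA: "S \<subseteq> A"
    using S unfolding lower_simplices_def by blast
  obtain c' where c': "\<And>v. v \<in> S' \<Longrightarrow> w v = c' \<bullet> v" "\<And>v. v \<in> A - S' \<Longrightarrow> w v > c' \<bullet> v" and SA': "S' \<subseteq> A"
    using S' unfolding lower_simplices_def by blast
  have fS: "finite S" "finite S'" using SA SA' fin finite_subset by blast+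
  show "convex hull S \<inter> convex hull S' \<subseteq> convex hull (S \<inter> S')"
  proof
    fix x assume x: "x \<in> convex hull S \<inter> convex hull S'"
    then obtain l where l: "\<And>v. v \<in> S \<Longrightarrow> 0 \<le> l v" "sum l S = 1" "(\<Sum>v\<in>S. l v *\<^sub>R v) = x"
      using convex_hull_finite[OF fS(1)] by auto
    obtain m where m: "\<And>v. v \<in> S' \<Longrightarrow> 0 \<le> m v" "sum m S' = 1" "(\<Sum>v\<in>S'. m v *\<^sub>R v) = x"
      using x convex_hull_finite[OF fS(2)] by auto
    have "c \<bullet> x = (\<Sum>v\<in>S. l v * w v)"
      unfolding l(3)[symmetric] inner_sum_right using c(1) by (auto intro!: sum.cong)
    moreover have "c' \<bullet> x = (\<Sum>v\<in>S'. m v * w v)"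
      unfolding m(3)[symmetric] inner_sum_right using c'(1) by (auto intro!: sum.cong)
    moreover have "c \<bullet> x \<le> (\<Sum>v\<in>S'. m v * w v)"
      using lower_face_le_combination(1)[where l = m, OF fin SA SA' c m(1)] m(3) by simp
    moreover have "c' \<bullet> x \<le> (\<Sum>v\<in>S. l v * w v)"
      using lower_face_le_combination(1)[where l = l, OF fin SA' SA c' l(1)] l(3) by simp
    ultimately have "c \<bullet> x = (\<Sum>v\<in>S'. m v * w v)" by simp
    then have m0: "\<forall>v\<in>S' - S \<inter> S'. m v = 0"
      using lower_face_le_combination(2)[where l = m, OF fin SA SA' c m(1)] m(3) by blast
    have "sum m (S \<inter> S') = 1" "(\<Sum>v\<in>S \<inter> S'. m v *\<^sub>R v) = x"
      unfolding m(2,3)[symmetric] using fS m0 by (auto intro!: sum.mono_neutral_left)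
    then show "x \<in> convex hull (S \<inter> S')"
      using m(1) fS by (subst convex_hull_finite) auto
  qed
qed

lemma regular_triangulation_lower_simplices:
  fixes A :: "(real^'n) set"
  assumes fin: "finite A" and spA: "span A = UNIV" and hyp: "\<And>v. v \<in> A \<Longrightarrow> a \<bullet> v = 1"
    and gen: "generic_height A w"
  shows "regular_triangulation A (lower_simplices A w)"
proof -
  have sub: "S \<subseteq> A" "independent S" "span S = UNIV" if "S \<in> lower_simplices A w" for S
    using that unfolding lower_simplices_def by blast+
  have "finite (lower_simplices A w)"
    using finite_subset[of _ "Pow A"] fin sub(1) by blast
  moreover have "affine hull S = affine hull A" if "S \<in> lower_simplices A w" for S
    using affine_hull_spanning_in_hyperplane[of S a] affine_hull_spanning_in_hyperplane[OF fin spA hyp]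
      sub[OF that] fin hyp finite_subset by (metis subsetD)
  moreover have "\<not> affine_dependent S" if "S \<in> lower_simplices A w" for S
    using sub(2)[OF that] affine_dependent_imp_dependent by blast
  ultimately have "triangulation A (lower_simplices A w)"
    unfolding triangulation_def
    by (intro conjI ballI sub(1) lower_simplices_cover[OF fin spA hyp gen] lower_simplices_inter[OF fin])
  moreover have "\<exists>c h. (\<forall>v\<in>S. w v = c \<bullet> v + h) \<and> (\<forall>v\<in>A - S. w v > c \<bullet> v + h)"
    if "S \<in> lower_simplices A w" for S
    using that unfolding lower_simplices_def by simp (metis add_0_right)
  ultimately show ?thesis unfolding regular_triangulation_def by blast
qed

subsection \<open>Parity of walks and unimodular cells\<close>

lemma rho_doubleton: "x \<noteq> y \<Longrightarrow> rho {x, y} = axis x 1 + axis y 1"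
  by (auto simp: vec_eq_iff rho_nth axis_def)

lemma edge_neq: "simple_graph F \<Longrightarrow> {x, y} \<in> F \<Longrightarrow> x \<noteq> y"
  unfolding simple_graph_def by force

definition edge_lattice :: "'n::finite set set \<Rightarrow> (real^'n) set" where
  "edge_lattice F = {x. \<exists>k :: 'n set \<Rightarrow> int. x = (\<Sum>e\<in>F. of_int (k e) *\<^sub>R rho e)}"

lemma edge_lattice_zero: "0 \<in> edge_lattice F"
  unfolding edge_lattice_def by (auto intro: exI[of _ "\<lambda>_. 0"])

lemma edge_lattice_add: "x \<in> edge_lattice F \<Longrightarrow> y \<in> edge_lattice F \<Longrightarrow> x + y \<in> edge_lattice F"
  unfolding edge_lattice_def
proof clarify
  fix k l :: "'a set \<Rightarrow> int"
  show "\<exists>m::'a set \<Rightarrow> int. (\<Sum>e\<in>F. of_int (k e) *\<^sub>R rho e) + (\<Sum>e\<in>F. of_int (l e) *\<^sub>R rho e)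
      = (\<Sum>e\<in>F. of_int (m e) *\<^sub>R rho e)"
    by (intro exI[of _ "\<lambda>e. k e + l e"]) (simp add: scaleR_add_left sum.distrib)
qed

lemma edge_lattice_scale: "x \<in> edge_lattice F \<Longrightarrow> of_int n *\<^sub>R x \<in> edge_lattice F"
  unfolding edge_lattice_def
proof clarify
  fix k :: "'a set \<Rightarrow> int"
  show "\<exists>m::'a set \<Rightarrow> int. of_int n *\<^sub>R (\<Sum>e\<in>F. of_int (k e) *\<^sub>R rho e)
      = (\<Sum>e\<in>F. of_int (m e) *\<^sub>R rho e)"
    by (intro exI[of _ "\<lambda>e. n * k e"]) (simp add: scaleR_sum_right)
qed

lemma edge_lattice_sum: "(\<And>i. i \<in> I \<Longrightarrow> f i \<in> edge_lattice F) \<Longrightarrow> sum f I \<in> edge_lattice F"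
  by (induction I rule: infinite_finite_induct) (auto intro: edge_lattice_zero edge_lattice_add)

lemma rho_in_edge_lattice:
  assumes "e \<in> F"
  shows "rho e \<in> edge_lattice F"
proof -
  have "(\<Sum>e'\<in>F. of_int (if e' = e then 1 else 0) *\<^sub>R rho e') = rho e"
    using assms by (subst sum.remove[of F e]) auto
  then show ?thesis
    unfolding edge_lattice_def by (intro CollectI exI[of _ "\<lambda>e'. if e' = e then 1 else 0"]) simp
qed

lemma edge_lattice_subset_span: "edge_lattice F \<subseteq> span (rho ` F)"
  unfolding edge_lattice_def by clarify (intro span_sum span_scale span_base imageI)

text \<open>Walks in the bipartite double cover record the parity of the length of a walk.\<close>

definition parity_steps :: "'n set set \<Rightarrow> (('n \<times> bool) \<times> ('n \<times> bool)) set" where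
  "parity_steps F = {((x, p), (y, q)). {x, y} \<in> F \<and> q = (\<not> p)}"

lemma sym_parity_steps: "sym ((parity_steps F)\<^sup>*)"
  by (intro sym_rtrancl symI) (auto simp: parity_steps_def insert_commute)

lemma parity_steps_flip:
  "((x, p), (y, q)) \<in> (parity_steps F)\<^sup>* \<Longrightarrow> ((x, \<not> p), (y, \<not> q)) \<in> (parity_steps F)\<^sup>*"
proof (induction rule: rtrancl_induct2)
  case (step y q z r)
  then have "((y, \<not> q), (z, \<not> r)) \<in> parity_steps F" by (simp add: parity_steps_def)
  with step.IH show ?case by (rule rtrancl_into_rtrancl)
qed simp

text \<open>Edge vectors along a walk, added with alternating signs, telescope to the two end
  vertices: even length (\<open>p = q\<close>) gives a difference, odd length a sum.\<close>

lemma parity_walk_edge_lattice: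
  assumes "simple_graph F" and "((u, p), (v, q)) \<in> (parity_steps F)\<^sup>*"
  shows "axis u 1 - (if p = q then 1 else -1) *\<^sub>R axis v 1 \<in> edge_lattice F"
  using assms(2)
proof (induction rule: rtrancl_induct2)
  case refl
  then show ?case by (simp add: edge_lattice_zero)
next
  case (step y q z r)
  have yz: "{y, z} \<in> F" and r: "r = (\<not> q)" using step.hyps(2) by (auto simp: parity_steps_def)
  \<comment> \<open>The current end \<open>y\<close> has coefficient \<open>- ?s\<close>; adding
    \<open>?s\<close> times the next edge vector cancels it and gives \<open>z\<close> the opposite
    coefficient.\<close>
  let ?s = "if p = q then 1 else -1 :: int"
  have "axis u 1 - of_int ?s *\<^sub>R axis y 1 + of_int ?s *\<^sub>R rho {y, z} \<in> edge_lattice F"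
    using step.IH by (intro edge_lattice_add edge_lattice_scale rho_in_edge_lattice yz) (auto split: if_splits)
  then show ?case
    unfolding rho_doubleton[OF edge_neq[OF assms(1) yz]] r by (auto simp: algebra_simps)
qed

text \<open>Connectedness of the bipartite double cover; for simple graphs this amounts to
  \<open>F\<close> being connected and not bipartite.\<close>

definition parity_connected :: "'n set set \<Rightarrow> bool" where
  "parity_connected F \<longleftrightarrow> (\<forall>a b. (a, b) \<in> (parity_steps F)\<^sup>*)"

text \<open>Connectedness provides walks of some parity from both vertices to \<open>z\<close>, and
  the odd closed walk at \<open>z\<close> corrects the parity.\<close>

lemma parity_connectedI:
  assumes "connected_graph F" and odd: "((z, False), (z, True)) \<in> (parity_steps F)\<^sup>*"
  shows "parity_connected F"
proof -
  have step: "\<exists>q. ((u, p), (v, q)) \<in> (parity_steps F)\<^sup>*" for u v p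
  proof -
    have "(u, v) \<in> {(x, y). {x, y} \<in> F}\<^sup>*"
      using assms(1) unfolding connected_graph_def by blast
    then show ?thesis
    proof (induction rule: rtrancl_induct)
      case (step y w)
      then obtain q where "((u, p), (y, q)) \<in> (parity_steps F)\<^sup>*" by blast
      moreover have "((y, q), (w, \<not> q)) \<in> parity_steps F"
        using step.hyps by (simp add: parity_steps_def)
      ultimately show ?case by (meson rtrancl_into_rtrancl)
    qed blast
  qed
  have z: "((z, p), (z, q)) \<in> (parity_steps F)\<^sup>*" for p q
    using odd parity_steps_flip[OF odd] by (cases p; cases q) auto
  have "((u, p), (v, q)) \<in> (parity_steps F)\<^sup>*" for u v p q
  proof -
    obtain r where r: "((u, p), (z, r)) \<in> (parity_steps F)\<^sup>*" using step by blast
    obtain s where "((v, q), (z, s)) \<in> (parity_steps F)\<^sup>*" using step by blast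
    then have "((z, s), (v, q)) \<in> (parity_steps F)\<^sup>*" using sym_parity_steps by (meson symD)
    then show ?thesis using r z[of r s] by (meson rtrancl_trans)
  qed
  then show ?thesis unfolding parity_connected_def by auto
qed

lemma parity_connected_edge_lattice:
  assumes F: "simple_graph F" "parity_connected F"
  shows "axis u 1 - axis v 1 \<in> edge_lattice F" "2 *\<^sub>R axis u 1 \<in> edge_lattice F"
  using parity_walk_edge_lattice[OF F(1), of u False v False] F(2)
    parity_walk_edge_lattice[OF F(1), of u False u True]
  unfolding parity_connected_def by (auto simp: scaleR_2)

lemma vec_eq_sum_axis: "x = (\<Sum>i\<in>UNIV. (x $ i) *\<^sub>R axis i 1)" for x :: "real^'n"
  using basis_expansion[of x] by (simp add: scalar_mult_eq_scaleR)

lemma parity_connected_span: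
  assumes "simple_graph F" "parity_connected F"
  shows "span (rho ` F) = UNIV"
proof -
  have "axis u 1 \<in> span (rho ` F)" for u
    using parity_connected_edge_lattice(2)[OF assms, of u] edge_lattice_subset_span[of F]
      span_scale[of "2 *\<^sub>R axis u 1" "rho ` F" "1/2"] by auto
  then have "x \<in> span (rho ` F)" for x
    by (subst vec_eq_sum_axis) (intro span_sum span_scale)
  then show ?thesis by blast
qed

text \<open>Shifting all coordinates to one arbitrary vertex \<open>z\<close> writes
  \<open>x\<close> as an integer combination of differences of unit vectors plus twice the unit
  vector at \<open>z\<close>.\<close>

lemma parity_connected_lattice_point:
  fixes x :: "real^'n"
  assumes F: "simple_graph F" "parity_connected F"
    and x: "lattice_point x" "(\<Sum>i\<in>UNIV. x $ i) = 2"
  shows "x \<in> edge_lattice F"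
proof -
  fix z :: 'n
  have "\<exists>n. x $ i = of_int n" for i
    using x(1) unfolding lattice_point_def by (meson Ints_cases)
  then obtain n where n: "\<And>i. x $ i = of_int (n i)" by metis
  have "x = (\<Sum>i\<in>UNIV. (x $ i) *\<^sub>R (axis i 1 - axis z 1)) + (\<Sum>i\<in>UNIV. x $ i) *\<^sub>R axis z 1"
    by (subst (1) vec_eq_sum_axis) (simp add: scaleR_diff_right sum_subtractf scaleR_sum_left)
  also have "\<dots> = (\<Sum>i\<in>UNIV. of_int (n i) *\<^sub>R (axis i 1 - axis z 1)) + 2 *\<^sub>R axis z 1"
    using x(2) n by simp
  also have "\<dots> \<in> edge_lattice F"
    using parity_connected_edge_lattice[OF F]
    by (intro edge_lattice_add edge_lattice_sum edge_lattice_scale)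
  finally show ?thesis .
qed

text \<open>The list has one more entry than the walk has steps, so even length corresponds to a
  change of parity.\<close>

lemma parity_walk_list:
  assumes "((u, p), (v, q)) \<in> (parity_steps F)\<^sup>*"
  shows "\<exists>vs. vs \<noteq> [] \<and> hd vs = u \<and> last vs = v \<and> successively (\<lambda>x y. {x, y} \<in> F) vs \<and>
    (even (length vs) \<longleftrightarrow> p \<noteq> q)"
  using assms
proof (induction rule: rtrancl_induct2)
  case refl
  then show ?case by (intro exI[of _ "[u]"]) auto
next
  case (step y q z r)
  then obtain vs where "vs \<noteq> []" "hd vs = u" "last vs = y" "successively (\<lambda>x y. {x, y} \<in> F) vs"
    "even (length vs) \<longleftrightarrow> p \<noteq> q" by blast
  with step.hyps(2) show ?case
    by (intro exI[of _ "vs @ [z]"]) (auto simp: successively_append_iff parity_steps_def)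
qed

lemma successively_reachable:
  assumes "successively (\<lambda>x y. {x, y} \<in> F) vs" "y \<in> set vs"
  shows "(hd vs, y) \<in> {(x, y). {x, y} \<in> F}\<^sup>*"
  using assms
proof (induction vs)
  case (Cons x vs)
  show ?case
  proof (cases "y = x")
    case False
    then have y: "y \<in> set vs" using Cons.prems by simp
    then have "vs \<noteq> []" by auto
    then have "{x, hd vs} \<in> F" "successively (\<lambda>x y. {x, y} \<in> F) vs"
      using Cons.prems(1) by (auto simp: successively_Cons)
    then show ?thesis using Cons.IH y by (auto intro: converse_rtrancl_into_rtrancl)
  qed simp
qed simp

text \<open>Even list length again means an odd number of steps. A repeated vertex splits the closed
  walk into two shorter ones, one of them odd; without repetition it is itself a cycle.\<close>

lemma odd_closed_walk_contains_odd_cycle: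
  assumes "simple_graph F" "successively (\<lambda>x y. {x, y} \<in> F) xs" "xs \<noteq> []" "hd xs = last xs"
    "even (length xs)"
  shows "\<exists>cs. cycle_list F cs \<and> odd (length cs) \<and> set cs \<subseteq> set xs"
  using assms(2-)
proof (induction xs rule: length_induct)
  case (1 xs)
  then obtain x ys where xs: "xs = x # ys" by (cases xs) auto
  have ne: "ys \<noteq> []" using 1(5) xs by auto
  have lastx: "last ys = x" using 1(4) ne xs by simp
  have suc: "successively (\<lambda>x y. {x, y} \<in> F) ys" "{x, hd ys} \<in> F"
    using 1(2) ne xs by (auto simp: successively_Cons)
  have odd: "odd (length ys)" using 1(5) xs by simp
  show ?case
  proof (cases "distinct ys")
    case True
    have "length ys \<noteq> 1"
      using suc(2) lastx edge_neq[OF assms(1), of x x] by (auto simp: length_Suc_conv)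
    then have len: "length ys \<ge> 3" using odd by presburger
    have "{ys ! i, ys ! (Suc i mod length ys)} \<in> F" if i: "i < length ys" for i
    proof (cases "Suc i = length ys")
      case True
      then have "ys ! i = x" using lastx ne by (metis diff_Suc_1 last_conv_nth)
      then show ?thesis using suc(2) True ne by (simp add: hd_conv_nth)
    next
      case False
      then show ?thesis using suc(1) i by (auto simp: successively_conv_nth)
    qed
    then show ?thesis using True len odd xs unfolding cycle_list_def by auto
  next
    case False
    then obtain as y bs cs where ys: "ys = as @ [y] @ bs @ [y] @ cs"
      using not_distinct_decomp by blast
    \<comment> \<open>\<open>?p\<close> is the loop between two visits of \<open>y\<close>, and
      \<open>?q\<close> the walk with this loop cut out. Their lengths add up to
      \<open>length xs + 1\<close>, which is odd, so one of them is even.\<close>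
    let ?p = "y # bs @ [y]" and ?q = "x # as @ [y] @ cs"
    have p: "successively (\<lambda>x y. {x, y} \<in> F) ?p"
      using suc(1) unfolding ys
      by (auto simp: successively_append_iff successively_Cons hd_append split: if_splits)
    have q: "successively (\<lambda>x y. {x, y} \<in> F) ?q"
      using 1(2) unfolding xs ys by (auto simp: successively_append_iff successively_Cons hd_append)
    have lq: "last ?q = x" using lastx unfolding ys by auto
    have len: "length ?p < length xs" "length ?q < length xs" unfolding xs ys by auto
    have "even (length ?p) \<or> even (length ?q)" using 1(5) unfolding xs ys by auto
    then show ?thesis
    proof
      assume "even (length ?p)"
      then obtain zs where "cycle_list F zs" "odd (length zs)" "set zs \<subseteq> set ?p"
        using 1(1)[rule_format, OF len(1) p] by auto
      then show ?thesis unfolding xs ys by auto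
    next
      assume "even (length ?q)"
      then obtain zs where "cycle_list F zs" "odd (length zs)" "set zs \<subseteq> set ?q"
        using 1(1)[rule_format, OF len(2) q] lq by auto
      then show ?thesis unfolding xs ys by auto
    qed
  qed
qed

section \<open>Cycles as vertex lists, and odd cycles in spanning subgraphs\<close>

lemma length_cyc_walk [simp]: "length (cyc_walk vs) = length vs"
  by (simp add: cyc_walk_def)

lemma nth_cyc_walk: "i < length vs \<Longrightarrow> cyc_walk vs ! i = {vs ! i, vs ! (Suc i mod length vs)}"
  by (simp add: cyc_walk_def)

text \<open>Equal edges at different positions are read in opposite directions, so each index is the
  cyclic successor of the other, which is impossible with at least 3 vertices.\<close>

lemma distinct_cyc_walk:
  assumes "distinct vs" "length vs \<ge> 3"
  shows "distinct (cyc_walk vs)"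
  unfolding distinct_conv_nth
proof (intro allI impI)
  let ?k = "length vs"
  fix i j assume i: "i < length (cyc_walk vs)" and j: "j < length (cyc_walk vs)" and "i \<noteq> j"
  have m: "Suc n mod ?k < ?k" for n using assms(2) by (intro mod_less_divisor) linarith
  show "cyc_walk vs ! i \<noteq> cyc_walk vs ! j"
  proof
    assume "cyc_walk vs ! i = cyc_walk vs ! j"
    then have "vs ! i = vs ! (Suc j mod ?k)" "vs ! (Suc i mod ?k) = vs ! j"
      using i j \<open>i \<noteq> j\<close> assms(1) by (auto simp: nth_cyc_walk doubleton_eq_iff nth_eq_iff_index_eq)
    then have "i = Suc j mod ?k" "Suc i mod ?k = j"
      using i j m assms(1) by (auto simp: nth_eq_iff_index_eq)
    then show False using assms(2) i j by (auto simp: mod_Suc split: if_splits)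
  qed
qed

lemma card_cyc_walk: "cycle_list E cs \<Longrightarrow> card (set (cyc_walk cs)) = length cs"
  using distinct_card[OF distinct_cyc_walk] unfolding cycle_list_def by fastforce

lemma cycle_verts_cyc_walk: "cycle_verts (set (cyc_walk cs)) = set cs"
proof
  show "cycle_verts (set (cyc_walk cs)) \<subseteq> set cs"
    by (auto simp: cycle_verts_def cyc_walk_def intro!: nth_mem mod_less_divisor)
  show "set cs \<subseteq> cycle_verts (set (cyc_walk cs))"
    by (force simp: cycle_verts_def cyc_walk_def in_set_conv_nth)
qed

lemma cyc_walk_subset: "cycle_list E cs \<Longrightarrow> set (cyc_walk cs) \<subseteq> E"
  by (auto simp: cycle_list_def cyc_walk_def)

lemma odd_cycle_cyc_walk: "cycle_list E cs \<Longrightarrow> odd (length cs) \<Longrightarrow> odd_cycle E (set (cyc_walk cs))"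
  unfolding odd_cycle_def is_cycle_def by (auto simp: card_cyc_walk)

lemma odd_cycle_parity_loop:
  assumes "cycle_list E cs" "odd (length cs)"
  shows "((cs ! 0, False), (cs ! 0, True)) \<in> (parity_steps E)\<^sup>*"
proof -
  let ?k = "length cs"
  have k: "?k \<ge> 3" using assms(1) unfolding cycle_list_def by blast
  have "((cs ! 0, False), (cs ! (i mod ?k), odd i)) \<in> (parity_steps E)\<^sup>*" for i
  proof (induction i)
    case (Suc i)
    have "{cs ! (i mod ?k), cs ! (Suc (i mod ?k) mod ?k)} \<in> E"
      using assms(1) k mod_less_divisor[of ?k i] unfolding cycle_list_def by fastforce
    then have "((cs ! (i mod ?k), odd i), (cs ! (Suc i mod ?k), odd (Suc i))) \<in> parity_steps E"
      by (simp add: parity_steps_def mod_Suc_eq)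
    with Suc.IH show ?case by (rule rtrancl_into_rtrancl)
  qed simp
  from this[of ?k] show ?thesis using assms(2) by simp
qed

text \<open>Without an odd closed walk at \<open>u\<close> the component of \<open>u\<close> is
  bipartite. The vector that is 1 on one side, -1 on the other and 0 elsewhere is orthogonal to all
  edge vectors, yet nonzero at \<open>u\<close>.\<close>

lemma spanning_parity_loop:
  fixes F :: "'n::finite set set"
  assumes "simple_graph F" "span (rho ` F) = UNIV"
  shows "((u, False), (u, True)) \<in> (parity_steps F)\<^sup>*"
proof (rule ccontr)
  let ?R = "(parity_steps F)\<^sup>*"
  assume nl: "((u, False), (u, True)) \<notin> ?R"
  have both: "\<not> (((u, False), (x, False)) \<in> ?R \<and> ((u, False), (x, True)) \<in> ?R)" for x
  proof
    assume a: "((u, False), (x, False)) \<in> ?R \<and> ((u, False), (x, True)) \<in> ?R"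
    then have "((x, True), (u, False)) \<in> ?R" using sym_parity_steps by (meson symD)
    then have "((x, False), (u, True)) \<in> ?R" using parity_steps_flip by fastforce
    then show False using a nl by (meson rtrancl_trans)
  qed
  define s :: "real^'n" where "s = (\<chi> x. if ((u, False), (x, False)) \<in> ?R then 1
    else if ((u, False), (x, True)) \<in> ?R then -1 else 0)"
  have "s \<bullet> rho e = 0" if e: "e \<in> F" for e
  proof -
    obtain x y where xy: "e = {x, y}" "x \<noteq> y"
      using e assms(1) unfolding simple_graph_def card_2_iff by metis
    have 1: "((x, p), (y, \<not> p)) \<in> parity_steps F" "((y, p), (x, \<not> p)) \<in> parity_steps F" for p
      using e xy by (auto simp: parity_steps_def insert_commute)
    have "((u, False), (y, \<not> p)) \<in> ?R \<longleftrightarrow> ((u, False), (x, p)) \<in> ?R" for p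
      using 1(1)[of p] 1(2)[of "\<not> p"] by (metis rtrancl.rtrancl_into_rtrancl)
    from this[of True] this[of False] show ?thesis
      unfolding inner_rho xy(1) s_def using xy(2) both[of x] both[of y] by auto
  qed
  then have "span (rho ` F) \<subseteq> {x. s \<bullet> x = 0}"
    by (intro span_minimal subspace_hyperplane) auto
  then have "s \<bullet> s = 0" using assms(2) by blast
  then have "s $ u = 0" by simp
  then show False unfolding s_def by simp
qed

text \<open>Spanning puts an odd cycle into every component; as no two odd cycles are disjoint,
  there is only one component.\<close>

lemma spanning_parity_connected:
  fixes F :: "'n::finite set set"
  assumes F: "simple_graph F" "span (rho ` F) = UNIV"
    and no: "\<And>C C'. odd_cycle F C \<Longrightarrow> odd_cycle F C' \<Longrightarrow> \<not> disjoint_cycles C C'"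
  shows "parity_connected F"
proof -
  let ?R = "{(x, y). {x, y} \<in> F}\<^sup>*"
  have symR: "sym ?R" by (intro sym_rtrancl symI) (auto simp: insert_commute)
  have "\<exists>cs. cycle_list F cs \<and> odd (length cs) \<and> (\<forall>y\<in>set cs. (u, y) \<in> ?R)" for u
  proof -
    obtain vs where vs: "vs \<noteq> []" "hd vs = u" "last vs = u" "even (length vs)"
        "successively (\<lambda>x y. {x, y} \<in> F) vs"
      using parity_walk_list[OF spanning_parity_loop[OF F, of u]] by auto
    then obtain cs where "cycle_list F cs" "odd (length cs)" "set cs \<subseteq> set vs"
      using odd_closed_walk_contains_odd_cycle[OF F(1) vs(5)] by auto
    then show ?thesis using successively_reachable[OF vs(5)] vs(2) by blast
  qed
  then obtain cs where cs: "\<And>u. cycle_list F (cs u)" "\<And>u. odd (length (cs u))"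
    "\<And>u y. y \<in> set (cs u) \<Longrightarrow> (u, y) \<in> ?R"
    by metis
  have "(u, v) \<in> ?R" for u v
  proof -
    have "set (cs u) \<inter> set (cs v) \<noteq> {}"
      using no[OF odd_cycle_cyc_walk[OF cs(1,2)] odd_cycle_cyc_walk[OF cs(1,2)], of u v]
      unfolding disjoint_cycles_def cycle_verts_cyc_walk .
    then obtain y where "(u, y) \<in> ?R" "(v, y) \<in> ?R" using cs(3) by blast
    then show ?thesis using symR by (meson rtrancl_trans symD)
  qed
  then have "connected_graph F" unfolding connected_graph_def by blast
  then show ?thesis by (rule parity_connectedI) (rule spanning_parity_loop[OF F])
qed

lemma rho_inner_half:
  assumes "simple_graph F" "e \<in> F"
  shows "(\<chi> i. 1/2) \<bullet> rho e = 1"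
  using assms unfolding simple_graph_def by (simp add: inner_rho)

text \<open>On the affine hull the coordinate sum is 2, so its lattice points lie in the edge
  lattice; pairing with the constant vector 1/2 shows that the integer coefficients sum to
  1.\<close>

lemma unimodular_simplex_rho:
  fixes F :: "'n::finite set set"
  assumes F: "simple_graph F" "parity_connected F" and ind: "independent (rho ` F)"
  shows "unimodular_simplex (rho ` F)"
  unfolding unimodular_simplex_def
proof (intro conjI ballI allI impI)
  show "\<not> affine_dependent (rho ` F)" using ind affine_dependent_imp_dependent by blast
  show "lattice_point v" if "v \<in> rho ` F" for v
    using that by (auto simp: lattice_point_def rho_nth)
  fix x :: "real^'n" assume x: "lattice_point x \<and> x \<in> affine hull (rho ` F)"
  have "affine hull (rho ` F) \<subseteq> {x. (\<chi> i. 1/2) \<bullet> x = 1}"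
    using rho_inner_half[OF F(1)] by (intro hull_minimal) (auto simp: affine_hyperplane)
  then have half: "(\<chi> i. 1/2) \<bullet> x = 1" using x by blast
  then have "(\<Sum>i\<in>UNIV. x $ i) = 2"
    unfolding inner_vec_def by (simp flip: sum_divide_distrib)
  then have "x \<in> edge_lattice F" using parity_connected_lattice_point[OF F] x by blast
  then obtain k :: "'n set \<Rightarrow> int" where k: "x = (\<Sum>e\<in>F. of_int (k e) *\<^sub>R rho e)"
    unfolding edge_lattice_def by blast
  have "1 = (\<Sum>e\<in>F. of_int (k e) * ((\<chi> i. 1/2) \<bullet> rho e))"
    using half unfolding k by (simp add: inner_sum_right)
  also have "\<dots> = (\<Sum>e\<in>F. of_int (k e))"
    using rho_inner_half[OF F(1)] by (intro sum.cong) auto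
  finally have k1: "(\<Sum>e\<in>F. of_int (k e)) = (1::real)" by simp
  have inj: "inj_on rho F" using inj_rho inj_on_subset by blast
  show "\<exists>c. (\<forall>v\<in>rho ` F. c v \<in> \<int>) \<and> sum c (rho ` F) = 1 \<and> (\<Sum>v\<in>rho ` F. c v *\<^sub>R v) = x"
    by (intro exI[of _ "\<lambda>v. of_int (k (inv rho v))"])
      (simp add: sum.reindex[OF inj] inv_f_f[OF inj_rho] k1 k)
qed simp

text \<open>A point \<open>u\<close> outside a spanning \<open>S\<close> is a fixed combination of
  \<open>S\<close>, and a tie at \<open>u\<close> makes the heights satisfy the same relation. Only
  finitely many such hyperplanes arise; \<open>g\<close> names the coordinate holding the height of
  a point.\<close>

lemma negligible_nongeneric_heights:
  fixes A :: "'a::euclidean_space set" and g :: "'a \<Rightarrow> 'k::finite"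
  assumes fin: "finite A" and inj: "inj_on g A"
  shows "negligible {x :: real^'k. \<not> generic_height A (\<lambda>v. x $ g v)}"
proof -
  define I where "I = {(S, u). S \<subseteq> A \<and> u \<in> A - S \<and> span S = UNIV}"
  have "\<exists>m. u = (\<Sum>v\<in>S. m v *\<^sub>R v)" if "(S, u) \<in> I" for S u
    using that fin finite_subset[of S A] span_finite[of S] unfolding I_def by auto
  then obtain m where m: "\<And>S u. (S, u) \<in> I \<Longrightarrow> u = (\<Sum>v\<in>S. m S u v *\<^sub>R v)" by metis
  \<comment> \<open>The normal vector of such a hyperplane. It is nonzero because injectivity of
    \<open>g\<close> leaves its coordinate \<open>g u\<close> equal to 1.\<close>
  define a :: "'a set \<times> 'a \<Rightarrow> real^'k"
    where "a = (\<lambda>(S, u). axis (g u) 1 - (\<Sum>v\<in>S. m S u v *\<^sub>R axis (g v) 1))"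
  have "a p \<noteq> 0" if "p \<in> I" for p
  proof -
    obtain S u where p: "p = (S, u)" by fastforce
    have "axis (g v) 1 $ g u = (0::real)" if "v \<in> S" for v
    proof -
      have "v \<in> A" "u \<in> A" "v \<noteq> u" using \<open>p \<in> I\<close> that unfolding p I_def by auto
      then have "g u \<noteq> g v" using inj by (auto simp: inj_on_eq_iff)
      then show ?thesis by (simp add: axis_def)
    qed
    then have "a p $ g u = 1" unfolding p a_def by simp
    then show ?thesis by auto
  qed
  moreover have "finite I"
    by (rule finite_subset[of _ "Pow A \<times> A"]) (use fin in \<open>auto simp: I_def\<close>)
  ultimately have "negligible (\<Union>p\<in>I. {x. a p \<bullet> x = 0})"
    by (intro negligible_Union) (auto intro: negligible_hyperplane)
  moreover have "{x. \<not> generic_height A (\<lambda>v. x $ g v)} \<subseteq> (\<Union>p\<in>I. {x. a p \<bullet> x = 0})"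
  proof clarify
    fix x :: "real^'k" assume "\<not> generic_height A (\<lambda>v. x $ g v)"
    then obtain S c u where S: "S \<subseteq> A" "span S = UNIV" "u \<in> A - S"
      and c: "\<And>v. v \<in> S \<Longrightarrow> c \<bullet> v = x $ g v" "c \<bullet> u = x $ g u"
      unfolding generic_height_def by blast
    then have I: "(S, u) \<in> I" unfolding I_def by blast
    have "x $ g u = (\<Sum>v\<in>S. m S u v * x $ g v)"
      unfolding c(2)[symmetric] using arg_cong[OF m[OF I], of "inner c"] c(1)
      by (simp add: inner_sum_right)
    then have "a (S, u) \<bullet> x = 0"
      unfolding a_def by (simp add: inner_diff_left inner_sum_left inner_axis')
    then show "x \<in> (\<Union>p\<in>I. {x. a p \<bullet> x = 0})" using I by blast
  qed
  ultimately show ?thesis by (rule negligible_subset)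
qed

section \<open>Alternating sums along even closed walks\<close>

text \<open>List positions start at 0, so the even-numbered edges of a walk are those at odd positions,
  which count positively.\<close>

definition alt_sum :: "('a \<Rightarrow> real) \<Rightarrow> 'a list \<Rightarrow> real" where
  "alt_sum f xs = (\<Sum>j<length xs. (-1) ^ Suc j * f (xs ! j))"

lemma alt_sum_append: "alt_sum f (xs @ ys) = alt_sum f xs + (-1) ^ length xs * alt_sum f ys"
proof (induction ys rule: rev_induct)
  case (snoc y ys)
  have s: "alt_sum f (zs @ [y]) = alt_sum f zs + (-1) ^ Suc (length zs) * f y" for zs
    by (simp add: alt_sum_def nth_append)
  show ?case
    using snoc s[of "xs @ ys"] s[of ys] by (simp add: power_add right_diff_distrib)
qed (simp add: alt_sum_def)

lemma alt_sum_linear: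
  "alt_sum (\<lambda>e. f e + g e) xs = alt_sum f xs + alt_sum g xs"
  "alt_sum (\<lambda>e. f e - g e) xs = alt_sum f xs - alt_sum g xs"
  "alt_sum (\<lambda>e. - f e) xs = - alt_sum f xs"
  "alt_sum (\<lambda>e. c * f e) xs = c * alt_sum f xs"
  unfolding alt_sum_def
  by (simp_all add: algebra_simps sum.distrib sum_subtractf sum_negf sum_distrib_left)

lemma alt_sum_sum: "alt_sum (\<lambda>e. \<Sum>i\<in>I. h i e) xs = (\<Sum>i\<in>I. alt_sum (h i) xs)"
  unfolding alt_sum_def sum_distrib_left by (rule sum.swap)

lemma alt_sum_split:
  "alt_sum f xs = (\<Sum>j\<in>{j. j < length xs \<and> odd j}. f (xs ! j))
    - (\<Sum>j\<in>{j. j < length xs \<and> even j}. f (xs ! j))"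
proof -
  have "alt_sum f xs = (\<Sum>j\<in>{j. j < length xs}. (if odd j then f (xs ! j) else 0)
      - (if even j then f (xs ! j) else 0))"
    unfolding alt_sum_def by (intro sum.cong) auto
  then show ?thesis
    unfolding sum_subtractf by (simp flip: sum.inter_filter)
qed

lemma alt_sum_zero: "(\<And>e. e \<in> set xs \<Longrightarrow> f e = 0) \<Longrightarrow> alt_sum f xs = 0"
  unfolding alt_sum_def by (intro sum.neutral) simp

lemma alt_sum_indicator_ge:
  assumes "distinct xs"
  shows "alt_sum (indicator {e}) xs \<ge> - indicator (set xs) e"
proof (cases "e \<in> set xs")
  case True
  then obtain i where i: "i < length xs" "xs ! i = e" by (auto simp: in_set_conv_nth)
  have "alt_sum (indicator {e}) xs = (\<Sum>j<length xs. if j = i then (-1) ^ Suc j else 0)"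
    unfolding alt_sum_def using i assms
    by (intro sum.cong) (auto simp: indicator_def nth_eq_iff_index_eq)
  also have "\<dots> = (-1) ^ Suc i" using i(1) by simp
  also have "\<dots> \<ge> - 1" by (cases "even i") auto
  finally show ?thesis using True by simp
next
  case False
  then have "alt_sum (indicator {e}) xs = 0" by (intro alt_sum_zero) (auto simp: indicator_def)
  then show ?thesis using False by simp
qed

text \<open>The sum telescopes around the cycle; as the number of edges is odd, the two end terms,
  both at the starting vertex, add up instead of cancelling.\<close>

lemma alt_sum_rho_cyc_walk:
  assumes "simple_graph E" "cycle_list E cs" "odd (length cs)"
  shows "alt_sum (\<lambda>e. c \<bullet> rho e) (cyc_walk cs) = - 2 * c $ hd cs"
proof -
  let ?k = "length cs"
  define h where "h j = c $ (cs ! (j mod ?k))" for j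
  have tel: "(\<Sum>j<n. (-1) ^ Suc j * (h j + h (Suc j))) = - h 0 + (-1) ^ n * h n" for n
    by (induction n) (auto simp: algebra_simps)
  have "c \<bullet> rho (cyc_walk cs ! j) = h j + h (Suc j)" if j: "j < ?k" for j
  proof -
    have "{cs ! j, cs ! (Suc j mod ?k)} \<in> E"
      using assms(2) j unfolding cycle_list_def by blast
    then have "cs ! j \<noteq> cs ! (Suc j mod ?k)" using edge_neq[OF assms(1)] by blast
    then show ?thesis unfolding nth_cyc_walk[OF j] inner_rho h_def using j by simp
  qed
  then have "alt_sum (\<lambda>e. c \<bullet> rho e) (cyc_walk cs) = (\<Sum>j<?k. (-1) ^ Suc j * (h j + h (Suc j)))"
    unfolding alt_sum_def length_cyc_walk by (intro sum.cong) auto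
  also have "\<dots> = - 2 * h 0" unfolding tel using assms(3) by (simp add: h_def)
  also have "h 0 = c $ hd cs" using assms(3) by (cases cs) (auto simp: h_def)
  finally show ?thesis .
qed

lemma odd_cycle_obtain:
  assumes "odd_cycle E C"
  obtains cs where "cycle_list E cs" "odd (length cs)" "C = set (cyc_walk cs)"
  using assms unfolding odd_cycle_def is_cycle_def by (auto simp: card_cyc_walk)

lemma disjoint_cycles_Int_empty:
  assumes "simple_graph E" "C \<subseteq> E" "disjoint_cycles C C'"
  shows "C \<inter> C' = {}"
proof (rule ccontr)
  assume "C \<inter> C' \<noteq> {}"
  then obtain e where e: "e \<in> C" "e \<in> C'" by blast
  then have "card e = 2" using assms(1,2) unfolding simple_graph_def by blast
  then have "e \<noteq> {}" by auto
  then show False using e assms(3) unfolding disjoint_cycles_def cycle_verts_def by blast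
qed

lemma even_closed_walk_decomp:
  assumes E: "simple_graph E" and C: "odd_cycle E C" "odd_cycle E C'" "disjoint_cycles C C'"
    and W: "even_closed_walk E b C C' W"
  obtains cs cs' where "cycle_list E cs" "cycle_list E cs'" "odd (length cs)" "odd (length cs')"
    "C = set (cyc_walk cs)" "C' = set (cyc_walk cs')" "b = {hd cs, hd cs'}" "hd cs \<noteq> hd cs'"
    "b \<notin> C" "b \<notin> C'" "C \<inter> C' = {}" "W = cyc_walk cs @ [b] @ cyc_walk cs' @ [b]"
proof -
  obtain cs cs' where cs: "b = {hd cs, hd cs'}" "cycle_list E cs" "C = set (cyc_walk cs)"
      "cycle_list E cs'" "C' = set (cyc_walk cs')" "W = cyc_walk cs @ [b] @ cyc_walk cs' @ [b]"
    using W unfolding even_closed_walk_def by blast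
  have odd: "odd (length cs)" "odd (length cs')"
    using C(1,2) cs card_cyc_walk unfolding odd_cycle_def by metis+
  then have "hd cs \<in> set cs" "hd cs' \<in> set cs'" by (auto intro!: hd_in_set)
  moreover have dis: "set cs \<inter> set cs' = {}"
    using C(3) unfolding disjoint_cycles_def cs(3,5) cycle_verts_cyc_walk .
  ultimately have hd: "hd cs \<notin> set cs'" "hd cs' \<notin> set cs" "hd cs \<noteq> hd cs'" by auto
  have "b \<notin> C" "b \<notin> C'"
    using hd cycle_verts_cyc_walk[of cs] cycle_verts_cyc_walk[of cs']
    unfolding cs(1,3,5) cycle_verts_def by blast+
  moreover have "C \<inter> C' = {}"
    using disjoint_cycles_Int_empty[OF E _ C(3)] cyc_walk_subset[OF cs(2)] cs(3) by blast
  ultimately show thesis using that cs odd hd by blast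
qed

text \<open>For a linear functional the cycles yield minus twice its values at the ends of
  \<open>b\<close>, cancelling the two visits of \<open>b\<close>. The lower bound on indicators
  holds since an edge lies on at most one of the disjoint cycles.\<close>

lemma alt_sum_even_closed_walk:
  assumes E: "simple_graph E" and C: "odd_cycle E C" "odd_cycle E C'" "disjoint_cycles C C'"
    and W: "even_closed_walk E b C C' W"
  shows "alt_sum (\<lambda>e. c \<bullet> rho e) W = 0"
    and "(\<And>e. e \<in> C \<union> C' \<Longrightarrow> f e = 0) \<Longrightarrow> alt_sum f W = 2 * f b"
    and "alt_sum (indicator {e}) W \<ge> -1"
    and "inj_on ((!) W) {j. j < length W \<and> W ! j \<noteq> b}"
    and "b \<notin> C \<union> C'"
proof -
  obtain cs cs' where cs: "cycle_list E cs" "cycle_list E cs'" "odd (length cs)" "odd (length cs')"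
    and CC: "C = set (cyc_walk cs)" "C' = set (cyc_walk cs')" and b: "b = {hd cs, hd cs'}" "hd cs \<noteq> hd cs'"
    and nb: "b \<notin> C" "b \<notin> C'" and dis: "C \<inter> C' = {}"
    and W': "W = cyc_walk cs @ [b] @ cyc_walk cs' @ [b]"
    using even_closed_walk_decomp[OF assms] by metis
  show "b \<notin> C \<union> C'" using nb by simp
  \<comment> \<open>As both cycles are odd, \<open>b\<close> sits at even-numbered places and counts
    positively twice, while each cycle starts at an odd-numbered place and keeps its own alternating
    sum.\<close>
  have alt: "alt_sum f W = 2 * f b + alt_sum f (cyc_walk cs) + alt_sum f (cyc_walk cs')" for f
    unfolding W' alt_sum_append using cs(3,4) by (simp add: alt_sum_def[of f "[b]"])
  show "alt_sum (\<lambda>e. c \<bullet> rho e) W = 0"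
    unfolding alt alt_sum_rho_cyc_walk[OF E cs(1,3)] alt_sum_rho_cyc_walk[OF E cs(2,4)]
    using b by (simp add: inner_rho)
  show "alt_sum f W = 2 * f b" if "\<And>e. e \<in> C \<union> C' \<Longrightarrow> f e = 0"
    unfolding alt using that CC by (simp add: alt_sum_zero)
  have dist: "distinct (cyc_walk cs)" "distinct (cyc_walk cs')"
    using cs distinct_cyc_walk unfolding cycle_list_def by blast+
  have "- indicator C e - indicator C' e \<ge> (-1::real)"
    using dis by (auto simp: indicator_def)
  then show "alt_sum (indicator {e}) W \<ge> -1"
    unfolding alt using alt_sum_indicator_ge[OF dist(1), of e] alt_sum_indicator_ge[OF dist(2), of e]
      indicator_pos_le[of "{e}" b, where 'a = real] unfolding CC by linarith
  \<comment> \<open>Without the final visit of \<open>b\<close> the walk has no repetitions, so only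
    \<open>b\<close> is visited twice.\<close>
  let ?D = "cyc_walk cs @ [b] @ cyc_walk cs'"
  have D: "distinct ?D" using dist nb dis unfolding CC by auto
  have "j < length ?D \<and> W ! j = ?D ! j" if "j < length W" "W ! j \<noteq> b" for j
  proof -
    have eq: "W = ?D @ [b]" unfolding W' by simp
    have "j \<noteq> length ?D" using that(2) unfolding eq by (metis nth_append_length)
    then have "j < length ?D" using that(1) unfolding eq by simp
    then show ?thesis unfolding eq by (simp only: nth_append if_True)
  qed
  then show "inj_on ((!) W) {j. j < length W \<and> W ! j \<noteq> b}"
    using D by (intro inj_onI) (metis (mono_tags, lifting) mem_Collect_eq nth_eq_iff_index_eq)
qed

section \<open>The total weight as an alternating sum\<close>

lemma cyc_walk_rotate: "cyc_walk (rotate n cs) = rotate n (cyc_walk cs)"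
proof (rule nth_equalityI)
  fix i assume "i < length (cyc_walk (rotate n cs))"
  then have i: "i < length cs" by simp
  then have k: "length cs > 0" by linarith
  show "cyc_walk (rotate n cs) ! i = rotate n (cyc_walk cs) ! i"
    using i mod_less_divisor[OF k] by (simp add: nth_cyc_walk nth_rotate mod_simps)
qed simp

text \<open>A cycle comes with an arbitrary starting vertex; rotation moves the start to an end of
  the bridge, as an even closed walk requires.\<close>

lemma cycle_list_rotate:
  assumes "cycle_list E cs" "u \<in> set cs"
  obtains cs' where "cycle_list E cs'" "set (cyc_walk cs') = set (cyc_walk cs)" "hd cs' = u"
proof -
  obtain n where n: "n < length cs" "cs ! n = u" using assms(2) by (auto simp: in_set_conv_nth)
  have alt: "cycle_list E xs \<longleftrightarrow> distinct xs \<and> length xs \<ge> 3 \<and> set (cyc_walk xs) \<subseteq> E" for xs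
    by (auto simp: cycle_list_def cyc_walk_def)
  have "cycle_list E (rotate n cs)" using assms(1) unfolding alt by (simp add: cyc_walk_rotate)
  moreover have "hd (rotate n cs) = u" using n hd_rotate_conv_nth[of cs n] by fastforce
  ultimately show thesis using that by (simp add: cyc_walk_rotate)
qed

lemma odd_cycle_pairsD:
  assumes "{C, C'} \<in> odd_cycle_pairs E"
  shows "odd_cycle E C" "odd_cycle E C'" "disjoint_cycles C C'"
proof -
  obtain D D' where "{C, C'} = {D, D'}" and D: "odd_cycle E D" "odd_cycle E D'" "disjoint_cycles D D'"
    using assms unfolding odd_cycle_pairs_def by blast
  then have "C = D \<and> C' = D' \<or> C = D' \<and> C' = D" by (simp add: doubleton_eq_iff)
  moreover have "disjoint_cycles D' D" using D(3) unfolding disjoint_cycles_def by blast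
  ultimately show "odd_cycle E C" "odd_cycle E C'" "disjoint_cycles C C'" using D by auto
qed

lemma even_closed_walk_exists:
  assumes "P \<in> odd_cycle_pairs E" "is_bridge_of_pair E P b"
  shows "\<exists>W C C'. P = {C, C'} \<and> even_closed_walk E b C C' W"
proof -
  obtain C C' where P: "P = {C, C'}" and br: "is_bridge E C C' b"
    using assms(2) unfolding is_bridge_of_pair_def by blast
  obtain u v where uv: "b = {u, v}" "u \<in> cycle_verts C" "v \<in> cycle_verts C'"
    using br unfolding is_bridge_def by blast
  have walk: "\<exists>xs. cycle_list E xs \<and> set (cyc_walk xs) = D \<and> hd xs = x"
    if "odd_cycle E D" "x \<in> cycle_verts D" for D x
  proof -
    obtain cs where cs: "cycle_list E cs" "D = set (cyc_walk cs)"
      using odd_cycle_obtain[OF \<open>odd_cycle E D\<close>] by blast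
    then have "x \<in> set cs" using that(2) cycle_verts_cyc_walk by metis
    then show ?thesis using cycle_list_rotate[OF cs(1)] cs(2) by metis
  qed
  obtain xs ys where "cycle_list E xs" "set (cyc_walk xs) = C" "hd xs = u"
    "cycle_list E ys" "set (cyc_walk ys) = C'" "hd ys = v"
    using walk[OF _ uv(2)] walk[OF _ uv(3)] odd_cycle_pairsD assms(1) unfolding P by metis
  then have "even_closed_walk E b C C' (cyc_walk xs @ [b] @ cyc_walk ys @ [b])"
    unfolding even_closed_walk_def using uv(1) by blast
  then show ?thesis using P by blast
qed

text \<open>The bridge \<open>b\<close> counts 2, and every other edge of the walk occurs once, so
  counting edges of a given parity is the same as counting positions.\<close>

lemma total_weight_eq_alt_sum:
  fixes E :: "'n::finite set set"
  assumes E: "simple_graph E" and P: "P \<in> odd_cycle_pairs E" "is_bridge_of_pair E P b"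
  shows "\<exists>C C' W. P = {C, C'} \<and> even_closed_walk E b C C' W \<and>
    (\<forall>B. b \<in> B \<longrightarrow> of_int (total_weight E B b P) = alt_sum (indicator B) W)"
proof -
  \<comment> \<open>The walk that \<open>total_weight\<close> selects; it does not depend on
    \<open>B\<close>.\<close>
  define W where "W = (SOME W. \<exists>C C'. P = {C, C'} \<and> even_closed_walk E b C C' W)"
  obtain C C' where C: "P = {C, C'}" and W: "even_closed_walk E b C C' W"
    using someI_ex[OF even_closed_walk_exists[OF P]] unfolding W_def by blast
  note CC = odd_cycle_pairsD[OF P(1)[unfolded C]]
  note walk = alt_sum_even_closed_walk[OF E CC W]
  have "of_int (total_weight E B b P) = alt_sum (indicator B) W" if b: "b \<in> B" for B
  proof -
    let ?X = "B - {b}"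
    have cnt: "(\<Sum>j\<in>{j. j < length W \<and> Q j}. indicator ?X (W ! j))
        = real (card {e \<in> set W. e \<in> ?X \<and> (\<exists>j<length W. W ! j = e \<and> Q j)})" for Q
    proof -
      let ?J = "{j. j < length W \<and> Q j \<and> W ! j \<in> ?X}"
      have "inj_on ((!) W) ?J" by (rule inj_on_subset[OF walk(4)]) auto
      then have "card ((!) W ` ?J) = card ?J" by (rule card_image)
      moreover have "(!) W ` ?J = {e \<in> set W. e \<in> ?X \<and> (\<exists>j<length W. W ! j = e \<and> Q j)}"
        by auto
      moreover have "(\<Sum>j\<in>{j. j < length W \<and> Q j}. indicator ?X (W ! j)) = real (card ?J)"
        by (subst sum.mono_neutral_right[of _ ?J]) (auto simp: indicator_def)
      ultimately show ?thesis by simp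
    qed
    have "alt_sum (indicator B) W = alt_sum (\<lambda>e. indicator {b} e + indicator ?X e) W"
      unfolding alt_sum_def using b by (intro sum.cong) (auto simp: indicator_def)
    also have "\<dots> = 2 + alt_sum (indicator ?X) W"
    proof -
      have "alt_sum (indicator {b}) W = 2 * indicator {b} b"
        using walk(5) by (intro walk(2)) (auto simp: indicator_def)
      then show ?thesis unfolding alt_sum_linear by simp
    qed
    also have "\<dots> = of_int (total_weight E B b P)"
      unfolding total_weight_def W_def[symmetric] Let_def alt_sum_split cnt
        even_numbered_def odd_numbered_def by simp
    finally show ?thesis by simp
  qed
  then show ?thesis using C W by blast
qed

section \<open>Heights that separate all pairs of disjoint odd cycles\<close>

theorem theorem2p3:
  fixes E :: "'n::finite set set"
    and b :: "'n set set set \<Rightarrow> 'n set"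
  assumes "simple_graph E"
    and "connected_graph E"
    and "fundamental_FHM_graph E"
    and "\<forall>P\<in>odd_cycle_pairs E. is_bridge_of_pair E P (b P)"
    and "\<forall>P\<in>odd_cycle_pairs E. total_weight E (b ` odd_cycle_pairs E) (b P) P \<ge> 0"
    and "card {P \<in> odd_cycle_pairs E. total_weight E (b ` odd_cycle_pairs E) (b P) P = 0} \<le> 2"
  shows "has_regular_unimodular_triangulation (rho ` E)"
proof -
  let ?P = "odd_cycle_pairs E" and ?A = "rho ` E"
  define B where "B = b ` ?P"
  define Z where "Z = {P \<in> ?P. total_weight E B (b P) P = 0}"
  obtain C C' W where CW: "\<And>P. P \<in> ?P \<Longrightarrow> P = {C P, C' P}"
    "\<And>P. P \<in> ?P \<Longrightarrow> even_closed_walk E (b P) (C P) (C' P) (W P)"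
    "\<And>P. P \<in> ?P \<Longrightarrow> of_int (total_weight E B (b P) P) = alt_sum (indicator B) (W P)"
  proof -
    have "\<exists>C C' W. P = {C, C'} \<and> even_closed_walk E (b P) C C' W \<and>
        of_int (total_weight E B (b P) P) = alt_sum (indicator B) W" if "P \<in> ?P" for P
    proof -
      have "b P \<in> B" using that unfolding B_def by blast
      then show ?thesis
        using total_weight_eq_alt_sum[OF assms(1) that] assms(4) that by metis
    qed
    then show thesis using that by metis
  qed
  have odd: "odd_cycle E (C P)" "odd_cycle E (C' P)" "disjoint_cycles (C P) (C' P)" if "P \<in> ?P" for P
    using odd_cycle_pairsD[of "C P" "C' P" E] CW(1)[OF that] that by simp_all
  note walk = alt_sum_even_closed_walk[OF assms(1) odd CW(2)]

  \<comment> \<open>The pairs of weight 0 are tilted by an extra unit on their own bridges: it contributes 2 to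
    the walk of its own pair and at least -1 to any other walk.\<close>
  define h :: "real^('n set)" where
    "h = (\<chi> e. - (3 * indicator B e + (\<Sum>Q\<in>Z. indicator {b Q} e)))"
  have h: "alt_sum (($) h) (W P) < 0" if P: "P \<in> ?P" for P
  proof -
    let ?s = "\<lambda>Q. alt_sum (indicator {b Q}) (W P)"
    have eq: "alt_sum (($) h) (W P) = - (3 * of_int (total_weight E B (b P) P) + sum ?s Z)"
    proof -
      have "($) h = (\<lambda>e. - (3 * indicator B e + (\<Sum>Q\<in>Z. indicator {b Q} e)))"
        unfolding h_def by auto
      then show ?thesis by (simp only: alt_sum_linear alt_sum_sum CW(3)[OF P])
    qed
    have ge: "?s Q \<ge> -1" for Q using walk(3)[OF P P P P] .
    have low: "sum ?s Y \<ge> - real (card Y)" for Y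
      using sum_mono[of Y "\<lambda>_. -1" ?s] ge by simp
    have cZ: "card Z \<le> 2" using assms(6) unfolding Z_def B_def .
    show ?thesis
    proof (cases "P \<in> Z")
      case True
      have "?s P = 2 * indicator {b P} (b P)"
        using walk(5)[OF P P P P] by (intro walk(2)[OF P P P P]) (auto simp: indicator_def)
      moreover have "sum ?s Z = ?s P + sum ?s (Z - {P})" using True by (simp add: sum.remove)
      moreover have "real (card (Z - {P})) \<le> 1" using cZ True by (simp add: card_Diff_singleton)
      moreover have "total_weight E B (b P) P = 0" using True unfolding Z_def by blast
      ultimately show ?thesis unfolding eq using low[of "Z - {P}"] by simp
    next
      \<comment> \<open>The weight is now a positive integer, so the factor 3 in \<open>h\<close>
        outweighs the loss of at most 2 caused by the pairs in \<open>Z\<close>.\<close>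
      case False
      then have "total_weight E B (b P) P \<ge> 1"
        using assms(5) P unfolding Z_def B_def by force
      then show ?thesis unfolding eq using low[of Z] cZ by linarith
    qed
  qed
  \<comment> \<open>These heights form an open set containing \<open>h\<close>, hence no null set,
    so a generic one can be found among them.\<close>
  define U :: "(real^('n set)) set" where "U = (\<Inter>P\<in>?P. {x. alt_sum (($) x) (W P) < 0})"
  have "open U"
    unfolding U_def alt_sum_def by (intro open_INT ballI open_Collect_less continuous_intros) simp
  moreover have "h \<in> U" using h unfolding U_def by blast
  ultimately have "\<not> negligible U" using open_not_negligible by blast
  \<comment> \<open>Heights are vectors indexed by vertex sets; \<open>inv rho\<close> recovers an
    edge from its vector.\<close>
  have inj: "inj_on (inv rho) ?A" by (rule inj_on_inv_into) auto
  obtain x where xU: "x \<in> U" and xg: "generic_height ?A (\<lambda>v. x $ inv rho v)"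
  proof -
    have "negligible {x. \<not> generic_height ?A (\<lambda>v. x $ inv rho v)}"
      by (rule negligible_nongeneric_heights[OF _ inj]) simp
    then have "\<not> U \<subseteq> {x. \<not> generic_height ?A (\<lambda>v. x $ inv rho v)}"
      using \<open>\<not> negligible U\<close> negligible_subset by blast
    then show thesis using that by blast
  qed
  define w where "w v = x $ inv rho v" for v
  have w: "w (rho e) = x $ e" for e unfolding w_def by (simp add: inv_f_f[OF inj_rho])

  have "parity_connected E"
  proof -
    obtain D where "odd_cycle E D" using assms(3) unfolding fundamental_FHM_graph_def by blast
    then obtain cs where "cycle_list E cs" "odd (length cs)" by (rule odd_cycle_obtain)
    then show ?thesis using parity_connectedI[OF assms(2)] odd_cycle_parity_loop by blast
  qed
  then have "span ?A = UNIV" by (rule parity_connected_span[OF assms(1)])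
  then have reg: "regular_triangulation ?A (lower_simplices ?A w)"
    using xg rho_inner_half[OF assms(1)] unfolding w_def
    by (intro regular_triangulation_lower_simplices[of _ "\<chi> i. 1/2"]) auto
  have "unimodular_simplex S" if S: "S \<in> lower_simplices ?A w" for S
  proof -
    obtain c where SA: "S \<subseteq> ?A" and ind: "independent S" and sp: "span S = UNIV"
      and c: "\<And>v. v \<in> S \<Longrightarrow> w v = c \<bullet> v" "\<And>v. v \<in> ?A - S \<Longrightarrow> w v > c \<bullet> v"
      using S unfolding lower_simplices_def by blast
    obtain F where F: "F \<subseteq> E" "S = rho ` F" using SA by (auto simp: subset_image_iff)
    have sF: "simple_graph F" using assms(1) F(1) unfolding simple_graph_def by blast
    have "\<not> disjoint_cycles D D'" if D: "odd_cycle F D" "odd_cycle F D'" for D D'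
    proof
      assume dis: "disjoint_cycles D D'"
      have DF: "odd_cycle E X \<and> X \<subseteq> F" if X: "odd_cycle F X" for X
      proof -
        obtain cs where cs: "cycle_list F cs" "odd (length cs)" "X = set (cyc_walk cs)"
          using X by (rule odd_cycle_obtain)
        moreover have "cycle_list E cs" using cs(1) F(1) unfolding cycle_list_def by blast
        ultimately show ?thesis using odd_cycle_cyc_walk cyc_walk_subset by blast
      qed
      let ?Q = "{D, D'}"
      have Q: "?Q \<in> ?P" using DF D dis unfolding odd_cycle_pairs_def by blast
      have "C ?Q \<in> ?Q" "C' ?Q \<in> ?Q" using CW(1)[OF Q] by blast+
      then have QF: "C ?Q \<union> C' ?Q \<subseteq> F" using DF D by blast
      \<comment> \<open>The gap between the lifting and the functional of \<open>S\<close> vanishes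
        on both cycles and is nonnegative on the bridge, so its alternating sum is at least 0.
        Subtracting the functional does not affect this sum, which is negative for
        \<open>x\<close>.\<close>
      define f where "f e = x $ e - c \<bullet> rho e" for e
      have "f e = 0" if "e \<in> C ?Q \<union> C' ?Q" for e
        using c(1)[of "rho e"] that QF w F(2) unfolding f_def by auto
      then have "alt_sum f (W ?Q) = 2 * f (b ?Q)" by (rule walk(2)[OF Q Q Q Q])
      moreover have "f (b ?Q) \<ge> 0"
      proof -
        have "b ?Q \<in> E" using assms(4) Q unfolding is_bridge_of_pair_def is_bridge_def by blast
        then show ?thesis
          using c(1)[of "rho (b ?Q)"] c(2)[of "rho (b ?Q)"] w[of "b ?Q"] unfolding f_def
          by (cases "rho (b ?Q) \<in> S") auto
      qed
      moreover have "alt_sum f (W ?Q) = alt_sum (($) x) (W ?Q)"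
        unfolding f_def alt_sum_linear walk(1)[OF Q Q Q Q] by simp
      moreover have "alt_sum (($) x) (W ?Q) < 0" using xU Q unfolding U_def by blast
      ultimately show False by simp
    qed
    then have "parity_connected F"
      using spanning_parity_connected[OF sF] sp unfolding F(2) by blast
    then show ?thesis using unimodular_simplex_rho[OF sF] ind unfolding F(2) by blast
  qed
  then show ?thesis
    unfolding has_regular_unimodular_triangulation_def using reg by blast
qed

end
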